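(* Let $\lambda>0$, $T>0$ and $p=1-e^{-\lambda T}$. Let $X_1,X_2,\dots$ be i.i.d. random variables with density $g_{\lambda,T}(x)=\lambda e^{-\lambda x}/(1-e^{-\lambda T})$, $0\le x\le T$, and let $c_n$ and $d_n$ be the connectivity and largest nearest neighbor distances of the graph $G_n(\lambda,\cdot,T)$ on $X_1,\dots,X_n$. Then 1. $\displaystyle\lim_{n\to\infty}\frac{n c_n}{\ln(n)}=\frac{p}{\lambda(1-p)}$ almost surely; 2. $\displaystyle\lim_{n\to\infty}\frac{n d_n}{\ln(n)}=\frac{p}{2\lambda(1-p)}$ almost surely.
   Context: $G_n(\lambda,r,T)$ is the graph with vertex set $\{X_1,\dots,X_n\}$ and an edge between $X_i$ and $X_j$ ($i\ne j$) if and only if $|X_i-X_j|\le r$. The connectivity distance is $c_n=\inf\{r>0: G_n(\lambda,r,T)\text{ is connected}\}$ and the largest nearest neighbor distance is $d_n=\max_{1\le i\le n}\min_{1\le j\le n,\,j\ne i}|X_i-X_j|$. *)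

theory Defs
  imports "Graph_Theory.Digraph_Component" "HOL-Probability.Probability"
begin

definition trunc_exp_density :: "real \<Rightarrow> real \<Rightarrow> real \<Rightarrow> real" where
  "trunc_exp_density l T x =
     (if 0 \<le> x \<and> x \<le> T then l * exp (- l * x) / (1 - exp (- l * T)) else 0)"

text \<open>
  For a realisation \<open>x\<close> of the sequence \<open>X\<^sub>1, X\<^sub>2, \<dots>\<close>, the vertex \<open>X\<^sub>i\<close> is represented by its
  index \<open>i\<close>, so that coinciding points (a null event) remain distinct vertices. An undirected
  edge is a pair of opposite arcs. The parameters of the distribution enter only through \<open>x\<close>.
\<close>
definition geom_graph :: "(nat \<Rightarrow> real) \<Rightarrow> nat \<Rightarrow> real \<Rightarrow> nat pair_pre_digraph" where
  "geom_graph x n r =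
     \<lparr>pverts = {1..n},
      parcs = {(i, j). i \<in> {1..n} \<and> j \<in> {1..n} \<and> i \<noteq> j \<and> \<bar>x i - x j\<bar> \<le> r}\<rparr>"

lemma pair_graph_geom_graph: "pair_graph (geom_graph x n r)"
proof
  have "parcs (geom_graph x n r) \<subseteq> {1..n} \<times> {1..n}"
    by (auto simp: geom_graph_def)
  then show "finite (parcs (geom_graph x n r))"
    by (rule finite_subset) simp
  show "symmetric (with_proj (geom_graph x n r))"
    by (auto simp: geom_graph_def symmetric_def arcs_ends_def arc_to_ends_def
        abs_minus_commute intro!: symI)
qed (auto simp: geom_graph_def)

text \<open>
  The name \<open>connected\<close> is qualified because it also denotes topological connectedness.
  The two distances below are meaningful for \<open>n \<ge> 1\<close> and \<open>n \<ge> 2\<close>, respectively.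
\<close>
definition connectivity_dist :: "(nat \<Rightarrow> real) \<Rightarrow> nat \<Rightarrow> real" where
  "connectivity_dist x n =
     Inf {r. r > 0 \<and> Digraph_Component.connected (with_proj (geom_graph x n r))}"

definition largest_nn_dist :: "(nat \<Rightarrow> real) \<Rightarrow> nat \<Rightarrow> real" where
  "largest_nn_dist x n = (MAX i\<in>{1..n}. MIN j\<in>{1..n} - {i}. \<bar>x i - x j\<bar>)"

end

theory Submission
  imports Defs "HOL-Real_Asymp.Real_Asymp"
begin

text \<open>
  Write \<open>L\<^sub>n = ln n / n\<close> and let \<open>f0 = l (1 - p) / p\<close>, the smallest value of the density on
  \<open>[0, T]\<close>, attained at the right endpoint \<open>T\<close>. A window of length \<open>b L\<^sub>n\<close> in which the density is
  about \<open>f\<close> contains no point of an \<open>n\<close>-sample with probability about \<open>n\<close> to the power \<open>- f b\<close>. There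
  are \<open>n\<close> sample points to which such a window can be attached, so empty windows disappear once
  \<open>b f > 1\<close> and persist as long as \<open>b f < 1\<close>. The places that keep them longest lie near \<open>T\<close>,
  whence the critical length \<open>L\<^sub>n / f0\<close>. Connectivity at distance \<open>r\<close> is about one-sided windows
  of length \<open>r\<close> to the right of a sample point, the nearest neighbour distance about two-sided
  windows of length \<open>2 r\<close>; this gives the limits \<open>1 / f0\<close> and \<open>1 / (2 f0)\<close>. Both cases are treated at
  once with the window \<open>[X\<^sub>i - \<alpha> L\<^sub>n, X\<^sub>i + \<beta> L\<^sub>n]\<close>, whose length has the coefficient
  \<open>\<alpha> + \<beta>\<close>.

  Two almost sure statements carry the proof. If \<open>(\<alpha> + \<beta>) f0 > 1\<close>, then eventually every
  sample point whose window lies in \<open>[0, T]\<close> has another sample point in its window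
  (\<open>AE_eventually_neighbour_interior\<close>, a union bound over the sample points). If
  \<open>(\<alpha> + \<beta>) f1 < 1\<close>, where \<open>f1\<close> bounds the density on an interval \<open>[u, v]\<close>, then eventually
  some sample point in \<open>[u, v]\<close> is alone in its window (\<open>AE_eventually_isolated\<close>, a second moment
  argument). Close to \<open>0\<close> and \<open>T\<close> a two-sided window sticks out of \<open>[0, T]\<close> and only half of it is
  useful, but there are only of the order of \<open>ln n\<close> sample points there, so any positive multiple of
  \<open>L\<^sub>n\<close> suffices for a neighbour (\<open>AE_eventually_neighbour_boundary\<close>).

  The probabilities obtained in this way decay like a small negative power of \<open>n\<close> and are not
  summable over \<open>n\<close>; moreover neither distance is monotone in \<open>n\<close>. The Borel-Cantelli lemma is
  therefore applied to blocks \<open>k\<^sup>m \<le> n < (k + 1)\<^sup>m\<close>. Within a block each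
  statement is proved in its worst case: points whose presence helps are sought among the first
  \<open>k\<^sup>m\<close> points only, points whose presence harms range over all \<open>(k + 1)\<^sup>m\<close>. As both numbers
  are asymptotically equal, the exponents hardly change, and a large \<open>m\<close> makes the bounds summable over \<open>k\<close>.
\<close>

section \<open>Geometric graphs of points on a line\<close>

lemma connected_geom_graph_iff:
  assumes "n \<ge> 1"
  shows "Digraph_Component.connected (with_proj (geom_graph x n r)) \<longleftrightarrow>
    (\<forall>u\<in>{1..n}. \<forall>v\<in>{1..n}. u \<rightarrow>\<^sup>*\<^bsub>with_proj (geom_graph x n r)\<^esub> v)"
proof -
  interpret pair_graph "geom_graph x n r" by (rule pair_graph_geom_graph)
  have "pverts (geom_graph x n r) = {1..n}" by (simp add: geom_graph_def)
  then show ?thesis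
    unfolding Digraph_Component.connected_def strongly_connected_def
    using reachable_mk_symmetric_eq[OF sym_arcs] assms by auto
qed

lemma parcs_geom_graph_iff:
  "(u, v) \<in> parcs (geom_graph x n r) \<longleftrightarrow> u \<in> {1..n} \<and> v \<in> {1..n} \<and> u \<noteq> v \<and> \<bar>x u - x v\<bar> \<le> r"
  by (auto simp: geom_graph_def)

text \<open>
  From the lower to the higher of two vertices one can walk upwards: the highest vertex reachable
  without passing the target is equal or adjacent to the target, or else it has a strictly higher
  neighbour, which contradicts its choice. The hypothesis speaks about positions to the right of
  \<open>x i\<close>, not about vertices other than \<open>i\<close>, because points may coincide.
\<close>
lemma connected_geom_graphI:
  assumes n: "n \<ge> 1"
    and step: "\<And>i j. i \<in> {1..n} \<Longrightarrow> j \<in> {1..n} \<Longrightarrow> x i + r < x j \<Longrightarrow>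
      \<exists>k\<in>{1..n}. x i < x k \<and> x k \<le> x i + r"
  shows "Digraph_Component.connected (with_proj (geom_graph x n r))"
    (is "Digraph_Component.connected ?G")
proof -
  interpret pair_graph "geom_graph x n r" by (rule pair_graph_geom_graph)
  have V: "verts ?G = {1..n}" by (simp add: geom_graph_def)
  have up: "u \<rightarrow>\<^sup>*\<^bsub>?G\<^esub> v" if u: "u \<in> {1..n}" and v: "v \<in> {1..n}" and le: "x u \<le> x v" and r: "r \<ge> 0" for u v
  proof -
    define R where "R = {w\<in>{1..n}. u \<rightarrow>\<^sup>*\<^bsub>?G\<^esub> w \<and> x w \<le> x v}"
    have "finite R" "u \<in> R" using u le V by (auto simp: R_def)
    then obtain w where w: "w \<in> R" and wmax: "\<And>y. y \<in> R \<Longrightarrow> x y \<le> x w"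
    proof -
      have "Max (x ` R) \<in> x ` R" using \<open>finite R\<close> \<open>u \<in> R\<close> by (intro Max_in) auto
      then obtain w where "w \<in> R" "x w = Max (x ` R)" by auto
      then show thesis using \<open>finite R\<close> by (intro that[of w]) auto
    qed
    have w': "w \<in> {1..n}" "u \<rightarrow>\<^sup>*\<^bsub>?G\<^esub> w" "x w \<le> x v" using w by (auto simp: R_def)
    show ?thesis
    proof (cases "x v \<le> x w + r")
      case True
      then have "w = v \<or> w \<rightarrow>\<^bsub>?G\<^esub> v"
        using w' v by (auto simp: parcs_geom_graph_iff)
      then show ?thesis using w'(2) reachable_adj_trans[OF w'(2)] by (elim disjE) simp_all
    next
      case False
      then obtain k where k: "k \<in> {1..n}" "x w < x k" "x k \<le> x w + r"
        using step[OF w'(1) v] by auto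
      then have "w \<rightarrow>\<^bsub>?G\<^esub> k" using w' by (auto simp: parcs_geom_graph_iff)
      then have "k \<in> R" using k False reachable_adj_trans[OF w'(2)] unfolding R_def by simp
      then show ?thesis using wmax k by force
    qed
  qed
  have "u \<rightarrow>\<^sup>*\<^bsub>?G\<^esub> v" if u: "u \<in> {1..n}" and v: "v \<in> {1..n}" for u v
  proof -
    have r: "r \<ge> 0 \<or> n = 1"
    proof (rule ccontr)
      assume "\<not> ?thesis"
      then have "x u + r < x u" by auto
      then obtain k where "x u < x k" "x k \<le> x u + r" using step[OF u u] by auto
      then show False using \<open>\<not> _\<close> by auto
    qed
    show ?thesis
    proof (cases "n = 1")
      case True
      then have "u = v" using u v by simp
      moreover have "v \<in> verts ?G" using v by (simp only: V)
      ultimately show ?thesis unfolding reachable_def by (simp only: rtrancl_on_refl)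
    next
      case False
      then have "r \<ge> 0" using r by auto
      show ?thesis
      proof (cases "x u \<le> x v")
        case True
        then show ?thesis by (rule up[OF u v _ \<open>r \<ge> 0\<close>])
      next
        case False
        then have "x v \<le> x u" by simp
        then show ?thesis by (rule symmetric_reachable'[OF up[OF v u _ \<open>r \<ge> 0\<close>]])
      qed
    qed
  qed
  then show ?thesis using n by (subst connected_geom_graph_iff) auto
qed

text \<open>
  No edge leads out of the set of vertices at or below \<open>x i\<close>.
\<close>
lemma not_connected_geom_graph_if_gap:
  assumes i: "i \<in> {1..n}" and j: "j \<in> {1..n}" "x i < x j"
    and gap: "\<And>k. k \<in> {1..n} \<Longrightarrow> x i < x k \<Longrightarrow> x i + r < x k"
  shows "\<not> Digraph_Component.connected (with_proj (geom_graph x n r))"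
proof
  interpret pair_graph "geom_graph x n r" by (rule pair_graph_geom_graph)
  let ?G = "with_proj (geom_graph x n r)"
  assume "Digraph_Component.connected ?G"
  then have "i \<rightarrow>\<^sup>*\<^bsub>?G\<^esub> j" using i j by (subst (asm) connected_geom_graph_iff) auto
  then have "x j \<le> x i"
  proof (induction rule: reachable_induct)
    case (step a b)
    have "b \<in> {1..n}" "\<bar>x a - x b\<bar> \<le> r" using step(2) by (auto simp: parcs_geom_graph_iff)
    then show ?case using gap[of b] step by force
  qed simp
  then show False using j by simp
qed

lemma connectivity_dist_le:
  assumes "n \<ge> 1" "r > 0"
    and "\<And>i j. i \<in> {1..n} \<Longrightarrow> j \<in> {1..n} \<Longrightarrow> x i + r < x j \<Longrightarrow>
      \<exists>k\<in>{1..n}. x i < x k \<and> x k \<le> x i + r"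
  shows "connectivity_dist x n \<le> r"
  unfolding connectivity_dist_def
  using connected_geom_graphI[of n x r] assms
  by (intro cInf_lower bdd_belowI[of _ 0]) auto

text \<open>
  Below the length of a gap the graph is disconnected. For the infimum to inherit this bound, some
  distance must connect the graph; one above the sum of all pairwise distances does.
\<close>
lemma connectivity_dist_ge:
  assumes i: "i \<in> {1..n}" and j: "j \<in> {1..n}" "x i < x j"
    and gap: "\<And>k. k \<in> {1..n} \<Longrightarrow> x i < x k \<Longrightarrow> x i + r < x k"
  shows "r \<le> connectivity_dist x n"
  unfolding connectivity_dist_def
proof (rule cInf_greatest)
  define R where "R = 1 + (\<Sum>a\<in>{1..n}. \<Sum>b\<in>{1..n}. \<bar>x a - x b\<bar>)"
  have R: "\<not> x a + R < x b" if "a \<in> {1..n}" "b \<in> {1..n}" for a b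
  proof -
    have "\<bar>x a - x b\<bar> \<le> (\<Sum>b\<in>{1..n}. \<bar>x a - x b\<bar>)"
      using that by (intro member_le_sum) auto
    also have "\<dots> \<le> (\<Sum>a\<in>{1..n}. \<Sum>b\<in>{1..n}. \<bar>x a - x b\<bar>)"
      using that by (intro member_le_sum[of a _ "\<lambda>a. \<Sum>b\<in>{1..n}. \<bar>x a - x b\<bar>"]) (auto intro: sum_nonneg)
    finally show ?thesis by (auto simp: R_def)
  qed
  have "Digraph_Component.connected (with_proj (geom_graph x n R))"
    using i R by (intro connected_geom_graphI) (auto dest!: R simp: not_less[symmetric])
  moreover have "R > 0" by (auto simp: R_def intro!: add_pos_nonneg sum_nonneg)
  ultimately show "{r. r > 0 \<and> Digraph_Component.connected (with_proj (geom_graph x n r))} \<noteq> {}" by auto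
next
  fix s assume s: "s \<in> {r. r > 0 \<and> Digraph_Component.connected (with_proj (geom_graph x n r))}"
  show "r \<le> s"
  proof (rule ccontr)
    assume "\<not> r \<le> s"
    then have "\<And>k. k \<in> {1..n} \<Longrightarrow> x i < x k \<Longrightarrow> x i + s < x k" using gap by force
    from not_connected_geom_graph_if_gap[OF i j this] s show False by auto
  qed
qed

lemma largest_nn_dist_le:
  assumes "n \<ge> 2" "\<And>i. i \<in> {1..n} \<Longrightarrow> \<exists>j\<in>{1..n} - {i}. \<bar>x i - x j\<bar> \<le> r"
  shows "largest_nn_dist x n \<le> r"
  unfolding largest_nn_dist_def
proof (subst Max_le_iff)
  show "\<forall>a\<in>(\<lambda>i. MIN j\<in>{1..n} - {i}. \<bar>x i - x j\<bar>) ` {1..n}. a \<le> r"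
  proof safe
    fix i assume "i \<in> {1..n}"
    then obtain j where "j \<in> {1..n} - {i}" "\<bar>x i - x j\<bar> \<le> r" using assms(2) by blast
    then show "(MIN j\<in>{1..n} - {i}. \<bar>x i - x j\<bar>) \<le> r"
      by (intro Min.coboundedI[THEN order_trans]) auto
  qed
qed (use assms in auto)

lemma largest_nn_dist_ge:
  assumes "n \<ge> 2" "i \<in> {1..n}" "\<And>j. j \<in> {1..n} - {i} \<Longrightarrow> r \<le> \<bar>x i - x j\<bar>"
  shows "r \<le> largest_nn_dist x n"
proof -
  have "{1..n} - {i} \<noteq> {}"
  proof -
    have "(if i = 1 then 2 else 1) \<in> {1..n} - {i}" using assms(1) by auto
    then show ?thesis by blast
  qed
  then have "r \<le> (MIN j\<in>{1..n} - {i}. \<bar>x i - x j\<bar>)"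
    using assms(3) by (subst Min_ge_iff) auto
  also have "\<dots> \<le> largest_nn_dist x n"
    unfolding largest_nn_dist_def using assms(2) by (intro Max_ge) auto
  finally show ?thesis .
qed

section \<open>Asymptotics along polynomial blocks\<close>

lemma eventually_of_eventually_blocks:
  assumes m: "m \<ge> 1"
    and ev: "eventually (\<lambda>k. \<forall>n\<in>{k ^ m..<Suc k ^ m}. P n) sequentially"
  shows "eventually P sequentially"
proof -
  obtain k0 where k0: "\<And>k n. k \<ge> k0 \<Longrightarrow> k ^ m \<le> n \<Longrightarrow> n < Suc k ^ m \<Longrightarrow> P n"
    using ev by (force simp: eventually_sequentially)
  have "P n" if n: "n \<ge> k0 ^ m" for n
  proof -
    define k where "k = (GREATEST k. k ^ m \<le> n)"
    have bd: "y \<le> n" if "y ^ m \<le> n" for y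
    proof (cases "y = 0")
      case False
      then have "y ^ 1 \<le> y ^ m" using m by (intro power_increasing) auto
      then show ?thesis using that by simp
    qed simp
    have 1: "k ^ m \<le> n" unfolding k_def by (rule GreatestI_nat[where P="\<lambda>k. k ^ m \<le> n", OF n bd])
    have 2: "k0 \<le> k" unfolding k_def by (rule Greatest_le_nat[where P="\<lambda>k. k ^ m \<le> n", OF n bd])
    have 3: "n < Suc k ^ m"
    proof (rule ccontr)
      assume "\<not> n < Suc k ^ m"
      then have "Suc k ^ m \<le> n" by simp
      then have "Suc k \<le> (GREATEST k. k ^ m \<le> n)" by (rule Greatest_le_nat[where P="\<lambda>k. k ^ m \<le> n", OF _ bd])
      then show False by (simp add: k_def)
    qed
    show ?thesis using k0[OF 2 1 3] .
  qed
  then show ?thesis by (auto simp: eventually_sequentially)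
qed

text \<open>
  The numerator and the denominator of \<open>ln n / n\<close> are replaced separately by their extreme values on
  the block; as both ends of the block are asymptotically equal, this costs nothing in the limit.
\<close>
lemma block_ln_over_le:
  assumes "n \<in> {k ^ m..<Suc k ^ m}" "k \<ge> 1"
  shows "ln (real (k ^ m)) / real (Suc k ^ m) \<le> ln (real n) / real n"
    and "ln (real n) / real n \<le> ln (real (Suc k ^ m)) / real (k ^ m)"
proof -
  have "k ^ m \<ge> 1" using assms(2) by simp
  then have "real 1 \<le> real (k ^ m)" by (simp only: of_nat_le_iff)
  moreover have "real (k ^ m) \<le> real n" "real n \<le> real (Suc k ^ m)"
    unfolding of_nat_le_iff using assms(1) by (simp_all only: atLeastLessThan_iff less_imp_le)
  ultimately show "ln (real (k ^ m)) / real (Suc k ^ m) \<le> ln (real n) / real n"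
    and "ln (real n) / real n \<le> ln (real (Suc k ^ m)) / real (k ^ m)"
    by (intro frac_le ln_mono ln_ge_zero; linarith)+
qed

lemma block_ratio_tendsto: "(\<lambda>k. real (Suc k ^ m) / real (k ^ m)) \<longlonglongrightarrow> 1"
proof -
  have "(\<lambda>k. (real (Suc k) / real k) ^ m) \<longlonglongrightarrow> 1 ^ m"
    by (intro tendsto_power) real_asymp
  then show ?thesis by (simp add: power_divide del: of_nat_Suc)
qed

lemma block_ln_ratio_tendsto:
  assumes "m \<ge> 1"
  shows "(\<lambda>k. ln (real (Suc k ^ m)) / ln (real (k ^ m))) \<longlonglongrightarrow> 1"
proof -
  have "(\<lambda>k. ln (real (Suc k)) / ln (real k)) \<longlonglongrightarrow> 1" by real_asymp
  moreover have "eventually (\<lambda>k. ln (real (Suc k)) / ln (real k) = ln (real (Suc k ^ m)) / ln (real (k ^ m))) sequentially"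
    using eventually_gt_at_top[of 0] by eventually_elim (use assms in \<open>simp add: ln_realpow del: of_nat_Suc\<close>)
  ultimately show ?thesis by (rule Lim_transform_eventually)
qed

lemma ln_block_over_block_le:
  assumes "k \<ge> 1" "m \<ge> 1"
  shows "ln (real (Suc k ^ m)) / real (k ^ m) \<le> real m * (ln (real (Suc k)) / real k ^ m)"
  using assms by (simp add: ln_realpow del: of_nat_Suc)

lemma block_threshold_tendsto_0:
  assumes m: "m \<ge> 1"
  shows "(\<lambda>k. ln (real (Suc k ^ m)) / real (k ^ m)) \<longlonglongrightarrow> 0"
proof (rule tendsto_sandwich)
  show "eventually (\<lambda>k. 0 \<le> ln (real (Suc k ^ m)) / real (k ^ m)) sequentially"
    by (intro always_eventually allI divide_nonneg_nonneg ln_ge_zero) auto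
  show "eventually (\<lambda>k. ln (real (Suc k ^ m)) / real (k ^ m) \<le> real m * (ln (real (Suc k)) / real k)) sequentially"
    using eventually_ge_at_top[of 1]
  proof eventually_elim
    case (elim k)
    have "real k ^ 1 \<le> real k ^ m" using elim m by (intro power_increasing) auto
    then have "ln (real (Suc k)) / real k ^ m \<le> ln (real (Suc k)) / real k"
      using elim by (intro divide_left_mono mult_pos_pos ln_ge_zero) auto
    then have "real m * (ln (real (Suc k)) / real k ^ m) \<le> real m * (ln (real (Suc k)) / real k)"
      by (rule mult_left_mono) simp
    with ln_block_over_block_le[OF elim m] show ?case by (rule order_trans)
  qed
  have "(\<lambda>k. ln (real (Suc k)) / real k) \<longlonglongrightarrow> 0" by real_asymp
  then show "(\<lambda>k. real m * (ln (real (Suc k)) / real k)) \<longlonglongrightarrow> 0" by (rule tendsto_mult_right_zero)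
qed simp

lemma summable_of_eventually_le_inverse_squares:
  assumes "eventually (\<lambda>k. 0 \<le> f k \<and> f k \<le> c * real k powr -2) sequentially"
  shows "summable f"
proof (rule summable_comparison_test_ev)
  show "summable (\<lambda>k. c * real k powr -2)"
    by (intro summable_mult) (simp add: summable_real_powr_iff)
  show "eventually (\<lambda>k. norm (f k) \<le> c * real k powr -2) sequentially"
    using assms by eventually_elim auto
qed

lemma summable_block_threshold:
  assumes m: "m \<ge> 3"
  shows "summable (\<lambda>k. ln (real (Suc k ^ m)) / real (k ^ m))"
proof (rule summable_of_eventually_le_inverse_squares[where c="real m"])
  have "eventually (\<lambda>k. ln (real (Suc k)) \<le> real k) sequentially" by real_asymp
  then show "eventually (\<lambda>k. 0 \<le> ln (real (Suc k ^ m)) / real (k ^ m) \<and> ln (real (Suc k ^ m)) / real (k ^ m) \<le> real m * real k powr -2) sequentially"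
    using eventually_ge_at_top[of 1]
  proof eventually_elim
    case (elim k)
    have "real k ^ 3 \<le> real k ^ m" using elim m by (intro power_increasing) auto
    then have "ln (real (Suc k)) / real k ^ m \<le> ln (real (Suc k)) / real k ^ 3"
      using elim by (intro divide_left_mono mult_pos_pos ln_ge_zero) auto
    also have "\<dots> \<le> real k / real k ^ 3" using elim by (intro divide_right_mono) auto
    also have "\<dots> = real k powr -2" using elim by (simp add: powr_minus powr_numeral field_simps power3_eq_cube power2_eq_square)
    finally have "real m * (ln (real (Suc k)) / real k ^ m) \<le> real m * real k powr -2"
      by (rule mult_left_mono) simp
    moreover have "0 \<le> ln (real (Suc k ^ m)) / real (k ^ m)"
      by (intro divide_nonneg_nonneg ln_ge_zero) auto
    ultimately show ?case using ln_block_over_block_le[of k m] elim m by linarith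
  qed
qed

text \<open>
  The left-hand side bounds the probability that \<open>k\<^sup>m - 1\<close> points all miss a set of
  probability \<open>\<theta> ln n / n\<close>, with \<open>ln n / n\<close> replaced by its lower bound on the block; the loss is
  absorbed in the gap between \<open>\<theta>'\<close> and \<open>\<theta>\<close>.
\<close>
lemma eventually_exp_block_le:
  assumes \<theta>: "\<theta>' < \<theta>" and m: "m \<ge> 1"
  shows "eventually (\<lambda>k. exp (- (real (k ^ m) - 1) * (\<theta> * (ln (real (k ^ m)) / real (Suc k ^ m))))
           \<le> real k powr (- (real m * \<theta>'))) sequentially"
proof -
  have "(\<lambda>k. \<theta> * ((1 - 1 / real (k ^ m)) * inverse (real (Suc k ^ m) / real (k ^ m)))) \<longlonglongrightarrow> \<theta> * ((1 - 0) * inverse 1)"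
  proof (intro tendsto_intros block_ratio_tendsto)
    have "filterlim (\<lambda>k. real (k ^ m)) at_top sequentially"
      using m by (intro filterlim_compose[OF filterlim_real_sequentially] filterlim_subseq)
        (auto simp: strict_mono_def intro: power_strict_mono)
    then show "(\<lambda>k. 1 / real (k ^ m)) \<longlonglongrightarrow> 0"
      by (intro real_tendsto_divide_at_top[OF tendsto_const])
  qed simp
  then have "eventually (\<lambda>k. \<theta>' < \<theta> * ((1 - 1 / real (k ^ m)) * inverse (real (Suc k ^ m) / real (k ^ m)))) sequentially"
    using \<theta> by (auto dest: order_tendstoD(1))
  then show ?thesis using eventually_ge_at_top[of 1]
  proof eventually_elim
    case (elim k)
    define N where "N = real (k ^ m)"
    define N' where "N' = real (Suc k ^ m)"
    have N: "N \<ge> 1" "N' > 0" using elim by (auto simp: N_def N'_def)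
    have "(1 - 1 / N) * inverse (N' / N) = (N - 1) / N'" using N by (simp add: field_simps)
    then have "\<theta>' \<le> \<theta> * ((N - 1) / N')" using elim unfolding N_def N'_def by simp
    then have "\<theta>' * ln N \<le> \<theta> * ((N - 1) / N') * ln N" using N by (intro mult_right_mono) auto
    moreover have "- (N - 1) * (\<theta> * (ln N / N')) = - (\<theta> * ((N - 1) / N') * ln N)"
      by (simp add: minus_divide_left[symmetric] algebra_simps diff_divide_distrib)
    ultimately have "- (N - 1) * (\<theta> * (ln N / N')) \<le> - \<theta>' * ln N" by linarith
    moreover have "ln N = real m * ln (real k)" using elim by (simp add: N_def ln_realpow)
    ultimately have "- (N - 1) * (\<theta> * (ln N / N')) \<le> - (real m * \<theta>') * ln (real k)" by (simp add: algebra_simps)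
    then show ?case using elim by (simp add: powr_def N_def N'_def)
  qed
qed

text \<open>
  The terms bound the expected number of sample points with an empty window of probability
  \<open>\<theta> ln n / n\<close>. This number is of the order \<open>n\<close> to the power \<open>1 - \<theta>\<close>, which is summable over the blocks when \<open>m (\<theta> - 1) > 1\<close>;
  the constant 4 leaves room for the losses.
\<close>
lemma summable_blocks_interior:
  assumes \<theta>: "\<theta> > 1" and m: "real m * (\<theta> - 1) \<ge> 4"
  shows "summable (\<lambda>k. real (Suc k ^ m) * exp (- (real (k ^ m) - 1) * (\<theta> * (ln (real (k ^ m)) / real (Suc k ^ m)))))"
proof (rule summable_of_eventually_le_inverse_squares[where c=2])
  define \<theta>' where "\<theta>' = (1 + \<theta>) / 2"
  have m1: "m \<ge> 1" using m by (cases m) auto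
  have "eventually (\<lambda>k. real (Suc k ^ m) / real (k ^ m) < 2) sequentially"
    using order_tendstoD(2)[OF block_ratio_tendsto[of m], of 2] by (simp del: of_nat_power)
  moreover have "\<theta>' < \<theta>" using \<theta> by (simp add: \<theta>'_def)
  note eventually_exp_block_le[OF this m1]
  ultimately show "eventually (\<lambda>k. 0 \<le> real (Suc k ^ m) * exp (- (real (k ^ m) - 1) * (\<theta> * (ln (real (k ^ m)) / real (Suc k ^ m)))) \<and>
     real (Suc k ^ m) * exp (- (real (k ^ m) - 1) * (\<theta> * (ln (real (k ^ m)) / real (Suc k ^ m)))) \<le> 2 * real k powr -2) sequentially"
    using eventually_ge_at_top[of 1]
  proof eventually_elim
    case (elim k)
    have "real (Suc k ^ m) \<le> 2 * real (k ^ m)" using elim by (simp add: field_simps)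
    also have "\<dots> = 2 * real k powr m" using elim by (simp add: powr_realpow)
    finally have "real (Suc k ^ m) * exp (- (real (k ^ m) - 1) * (\<theta> * (ln (real (k ^ m)) / real (Suc k ^ m)))) \<le> 2 * real k powr m * real k powr (- (real m * \<theta>'))"
      using elim by (intro mult_mono) auto
    also have "\<dots> = 2 * real k powr (real m * (1 - \<theta>'))" by (simp add: powr_add[symmetric] algebra_simps)
    also have "\<dots> \<le> 2 * real k powr -2"
      using elim m by (intro mult_left_mono powr_mono) (auto simp: \<theta>'_def field_simps)
    finally show ?case by simp
  qed
qed

text \<open>
  The additional factor is the order of the probability of lying within a multiple of \<open>ln n / n\<close> of
  an endpoint. With it the expectation is \<open>ln n\<close> times \<open>n\<close> to the power \<open>- \<theta>\<close>, so that every
  positive \<open>\<theta>\<close> is admissible.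
\<close>
lemma summable_blocks_boundary:
  assumes \<theta>: "\<theta> > 0" and m: "real m * \<theta> \<ge> 6"
  shows "summable (\<lambda>k. real (Suc k ^ m) * (ln (real (Suc k ^ m)) / real (k ^ m)) *
     exp (- (real (k ^ m) - 1) * (\<theta> * (ln (real (k ^ m)) / real (Suc k ^ m)))))"
proof (rule summable_of_eventually_le_inverse_squares[where c="2 * real m"])
  have m1: "m \<ge> 1" using m by (cases m) auto
  have "eventually (\<lambda>k. real (Suc k ^ m) / real (k ^ m) < 2) sequentially"
    using order_tendstoD(2)[OF block_ratio_tendsto[of m], of 2] by (simp del: of_nat_power)
  moreover have "\<theta> / 2 < \<theta>" using \<theta> by simp
  note eventually_exp_block_le[OF this m1]
  moreover have "eventually (\<lambda>k. ln (real (Suc k)) \<le> real k) sequentially" by real_asymp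
  ultimately show "eventually (\<lambda>k. 0 \<le> real (Suc k ^ m) * (ln (real (Suc k ^ m)) / real (k ^ m)) * exp (- (real (k ^ m) - 1) * (\<theta> * (ln (real (k ^ m)) / real (Suc k ^ m)))) \<and>
     real (Suc k ^ m) * (ln (real (Suc k ^ m)) / real (k ^ m)) * exp (- (real (k ^ m) - 1) * (\<theta> * (ln (real (k ^ m)) / real (Suc k ^ m)))) \<le> 2 * real m * real k powr -2) sequentially"
    using eventually_ge_at_top[of 1]
  proof eventually_elim
    case (elim k)
    have "real (Suc k ^ m) * (ln (real (Suc k ^ m)) / real (k ^ m)) = real (Suc k ^ m) / real (k ^ m) * (real m * ln (real (Suc k)))"
      using elim by (simp add: ln_realpow del: of_nat_Suc)
    also have "\<dots> \<le> 2 * (real m * real k)"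
      using elim by (intro mult_mono) auto
    finally have *: "real (Suc k ^ m) * (ln (real (Suc k ^ m)) / real (k ^ m)) \<le> 2 * (real m * real k)" .
    have "real (Suc k ^ m) * (ln (real (Suc k ^ m)) / real (k ^ m)) * exp (- (real (k ^ m) - 1) * (\<theta> * (ln (real (k ^ m)) / real (Suc k ^ m))))
       \<le> 2 * (real m * real k) * real k powr (- (real m * (\<theta> / 2)))"
      using elim by (intro mult_mono *) auto
    also have "\<dots> \<le> 2 * (real m * real k) * real k powr -3"
      using elim m by (intro mult_left_mono powr_mono) (auto simp: field_simps)
    also have "\<dots> = 2 * real m * real k powr -2"
      using elim by (simp add: powr_minus powr_numeral field_simps power3_eq_cube power2_eq_square)
    moreover have "0 \<le> ln (real (Suc k ^ m))" by (intro ln_ge_zero) auto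
    ultimately show ?case by auto
  qed
qed

text \<open>
  The matching lower bound for the probability that \<open>(k + 1)\<^sup>m\<close> points miss a set, from
  \<open>ln (1 - y) \<ge> - y / (1 - y)\<close>.
\<close>
lemma eventually_vacancy_block_ge:
  assumes \<theta>: "0 \<le> \<theta>" "\<theta> < \<theta>'" and m: "m \<ge> 1"
  shows "eventually (\<lambda>k. real k powr (- (real m * \<theta>')) \<le>
           (1 - \<theta> * (ln (real (Suc k ^ m)) / real (k ^ m))) ^ (Suc k ^ m)) sequentially"
proof -
  let ?U = "\<lambda>k. ln (real (Suc k ^ m)) / real (k ^ m)"
  note U = block_threshold_tendsto_0[OF m]
  have "(\<lambda>k. \<theta> / (1 - \<theta> * ?U k) * (real (Suc k ^ m) / real (k ^ m)) * (ln (real (Suc k ^ m)) / ln (real (k ^ m))))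
     \<longlonglongrightarrow> \<theta> / (1 - \<theta> * 0) * 1 * 1"
    by (intro tendsto_intros U block_ratio_tendsto block_ln_ratio_tendsto m) auto
  then have "eventually (\<lambda>k. \<theta> / (1 - \<theta> * ?U k) * (real (Suc k ^ m) / real (k ^ m)) * (ln (real (Suc k ^ m)) / ln (real (k ^ m))) < \<theta>') sequentially"
    using \<theta> by (auto dest: order_tendstoD(2))
  moreover have "(\<lambda>k. \<theta> * ?U k) \<longlonglongrightarrow> \<theta> * 0" by (intro tendsto_intros U)
  from order_tendstoD(2)[OF this, of 1] have "eventually (\<lambda>k. \<theta> * ?U k < 1) sequentially" by (simp del: of_nat_power)
  ultimately show ?thesis using eventually_ge_at_top[of 2]
  proof eventually_elim
    case (elim k)
    define N where "N = real (k ^ m)"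
    define N' where "N' = real (Suc k ^ m)"
    define y where "y = \<theta> * ?U k"
    have "k ^ m \<ge> 2 ^ m" using elim by (intro power_mono) auto
    moreover have "(2::nat) ^ 1 \<le> 2 ^ m" using m by (intro power_increasing) auto
    ultimately have "(2::nat) ^ 1 \<le> k ^ m" by (rule order_trans[rotated])
    then have "k ^ m > 1" by simp
    then have N: "N > 1" "N' \<ge> 1" unfolding N_def N'_def by (simp_all del: of_nat_power of_nat_Suc)
    have y: "0 \<le> y" "y < 1" using elim \<theta> by (auto simp: y_def intro!: mult_nonneg_nonneg divide_nonneg_nonneg ln_ge_zero)
    have lnN: "ln N > 0" "ln N = real m * ln (real k)"
      using N(1) elim by (simp, simp add: N_def ln_realpow)
    have "N' * (y / (1 - y)) = \<theta> / (1 - y) * (N' / N) * (ln N' / ln N) * ln N"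
      using lnN(1) by (simp add: y_def N_def N'_def mult.commute)
    also have "\<dots> \<le> \<theta>' * ln N" using elim lnN(1) by (intro mult_right_mono) (auto simp: y_def N_def N'_def)
    finally have 1: "N' * (y / (1 - y)) \<le> \<theta>' * ln N" .
    have "ln (1 / (1 - y)) \<le> 1 / (1 - y) - 1" using y by (intro ln_le_minus_one) auto
    also have "\<dots> = y / (1 - y)" using y by (simp add: field_simps)
    finally have "- ln (1 - y) \<le> y / (1 - y)" using y by (simp add: ln_div)
    then have "N' * (- ln (1 - y)) \<le> N' * (y / (1 - y))" using N by (intro mult_left_mono) auto
    with 1 have "- (\<theta>' * ln N) \<le> N' * ln (1 - y)" by linarith
    then have "exp (- (\<theta>' * ln N)) \<le> exp (N' * ln (1 - y))" by simp
    also have "\<dots> = (1 - y) ^ (Suc k ^ m)"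
      unfolding N'_def using y by (subst exp_of_nat_mult) (simp)
    finally show ?case using elim lnN by (simp add: y_def powr_def algebra_simps)
  qed
qed

section \<open>A second moment bound\<close>

text \<open>
  Chebyshev's inequality for the number \<open>Z\<close> of events that occur: if \<open>e\<close> is its expectation, the
  hypothesis on pairs bounds the variance by \<open>e + (C - 1) e\<^sup>2\<close>, while \<open>(Z - e)\<^sup>2 = e\<^sup>2\<close> where no
  event occurs.
\<close>
lemma (in prob_space) prob_no_event_le:
  assumes S: "finite S" and E [measurable]: "\<And>s. s \<in> S \<Longrightarrow> E s \<in> events"
    and pairs: "\<And>s t. s \<in> S \<Longrightarrow> t \<in> S \<Longrightarrow> s \<noteq> t \<Longrightarrow> prob (E s \<inter> E t) \<le> C * prob (E s) * prob (E t)"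
    and C: "C \<ge> 0" and \<mu>: "0 < \<mu>" "\<mu> \<le> (\<Sum>s\<in>S. prob (E s))"
  shows "prob (space M - (\<Union>s\<in>S. E s)) \<le> 1 / \<mu> + (C - 1)"
proof -
  define e where "e = (\<Sum>s\<in>S. prob (E s))"
  define Z where "Z = (\<lambda>\<omega>. \<Sum>s\<in>S. indicator (E s) \<omega> :: real)"
  have e: "e > 0" "\<mu> \<le> e" using \<mu> by (auto simp: e_def)
  have UN [measurable]: "(\<Union>s\<in>S. E s) \<in> events" using S by auto
  have int2: "integrable M (\<lambda>\<omega>. indicator (E s) \<omega> * indicator (E t) \<omega> :: real)" if "s \<in> S" "t \<in> S" for s t
    using that by (simp add: indicator_inter_arith[symmetric] emeasure_eq_measure)
  have int1: "integrable M (\<lambda>\<omega>. indicator (E s) \<omega> :: real)" if "s \<in> S" for s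
    using that by (simp add: emeasure_eq_measure)
  have Z: "integrable M Z" "expectation Z = e"
    using int1 by (auto simp: Z_def e_def)
  have ZZ: "(Z \<omega>)\<^sup>2 = (\<Sum>s\<in>S. \<Sum>t\<in>S. indicator (E s) \<omega> * indicator (E t) \<omega>)" for \<omega>
    by (simp add: Z_def power2_eq_square sum_product)
  have Z2: "integrable M (\<lambda>\<omega>. (Z \<omega>)\<^sup>2)"
    unfolding ZZ using int2 by auto
  have "expectation (\<lambda>\<omega>. (Z \<omega>)\<^sup>2) = (\<Sum>s\<in>S. \<Sum>t\<in>S. prob (E s \<inter> E t))"
    unfolding ZZ using int2 by (simp add: indicator_inter_arith[symmetric])
  also have "\<dots> \<le> (\<Sum>s\<in>S. \<Sum>t\<in>S. (if t = s then prob (E s) else 0) + C * prob (E s) * prob (E t))"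
  proof (intro sum_mono)
    fix s t assume "s \<in> S" "t \<in> S"
    then show "prob (E s \<inter> E t) \<le> (if t = s then prob (E s) else 0) + C * prob (E s) * prob (E t)"
      using pairs[of s t] C by (cases "s = t") auto
  qed
  also have "\<dots> = e + C * (e * e)"
    using S by (simp add: sum.distrib sum.delta e_def sum_product sum_distrib_left sum_distrib_right mult_ac)
  finally have var: "expectation (\<lambda>\<omega>. (Z \<omega>)\<^sup>2) \<le> e + C * (e * e)" .
  have int3: "integrable M (\<lambda>\<omega>. (Z \<omega> - e)\<^sup>2)"
    using Z Z2 by (simp add: power2_diff)
  have "e\<^sup>2 * prob (space M - (\<Union>s\<in>S. E s)) = expectation (\<lambda>\<omega>. e\<^sup>2 * indicator (space M - (\<Union>s\<in>S. E s)) \<omega>)"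
    by simp
  also have "\<dots> \<le> expectation (\<lambda>\<omega>. (Z \<omega> - e)\<^sup>2)"
  proof (rule integral_mono[OF _ int3])
    fix \<omega> assume "\<omega> \<in> space M"
    show "e\<^sup>2 * indicator (space M - (\<Union>s\<in>S. E s)) \<omega> \<le> (Z \<omega> - e)\<^sup>2"
    proof (cases "\<omega> \<in> (\<Union>s\<in>S. E s)")
      case False
      then have "Z \<omega> = 0" by (auto simp: Z_def intro!: sum.neutral)
      then show ?thesis by (auto simp: indicator_def)
    qed auto
  qed (simp add: emeasure_eq_measure)
  also have "\<dots> = expectation (\<lambda>\<omega>. (Z \<omega>)\<^sup>2 + e\<^sup>2 - 2 * Z \<omega> * e)"
    by (simp add: power2_diff)
  also have "\<dots> = expectation (\<lambda>\<omega>. (Z \<omega>)\<^sup>2) + e\<^sup>2 - 2 * e * e"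
    using Z Z2 by (simp add: prob_space)
  also have "\<dots> = expectation (\<lambda>\<omega>. (Z \<omega>)\<^sup>2) - e\<^sup>2"
    by (simp add: power2_eq_square)
  also have "\<dots> \<le> e\<^sup>2 * (1 / e + (C - 1))"
  proof -
    have "e\<^sup>2 * (1 / e + (C - 1)) = e + C * (e * e) - e\<^sup>2"
      using e by (simp add: field_simps power2_eq_square)
    then show ?thesis using var by simp
  qed
  finally have "prob (space M - (\<Union>s\<in>S. E s)) \<le> 1 / e + (C - 1)"
    using e by (subst (asm) mult_le_cancel_left_pos) auto
  also have "1 / e \<le> 1 / \<mu>" using e \<mu> by (intro divide_left_mono) auto
  finally show ?thesis by simp
qed

section \<open>Independent samples from a law on the line\<close>

locale iid_sample = prob_space M for M :: "'a measure" +
  fixes X :: "nat \<Rightarrow> 'a \<Rightarrow> real" and \<nu> :: "real measure"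
  assumes indep: "indep_vars (\<lambda>_. borel) X {1..}"
    and distr_X: "\<And>i. i \<ge> 1 \<Longrightarrow> distr M borel (X i) = \<nu>"
begin

lemma measurable_X [measurable]: "i \<ge> 1 \<Longrightarrow> X i \<in> borel_measurable M"
  using indep by (auto simp: indep_vars_def)

lemma law: "prob_space \<nu>" "sets \<nu> = sets borel" "space \<nu> = UNIV"
  using distr_X[of 1, symmetric] by (auto intro: prob_space_distr)

lemma prob_X:
  assumes "i \<ge> 1" "A \<in> sets borel"
  shows "prob {\<omega>\<in>space M. X i \<omega> \<in> A} = measure \<nu> A"
proof -
  have "measure \<nu> A = prob (X i -` A \<inter> space M)"
    using assms distr_X[of i, symmetric] by (simp add: measure_distr)
  also have "X i -` A \<inter> space M = {\<omega>\<in>space M. X i \<omega> \<in> A}" by auto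
  finally show ?thesis by simp
qed

lemma prob_all_in:
  assumes "finite J" "J \<subseteq> {1..}" "\<And>j. j \<in> J \<Longrightarrow> A j \<in> sets borel"
  shows "prob {\<omega>\<in>space M. \<forall>j\<in>J. X j \<omega> \<in> A j} = (\<Prod>j\<in>J. measure \<nu> (A j))"
proof (cases "J = {}")
  case False
  have "{\<omega>\<in>space M. \<forall>j\<in>J. X j \<omega> \<in> A j} = (\<Inter>j\<in>J. X j -` A j \<inter> space M)"
    using False by auto
  also have "prob \<dots> = (\<Prod>j\<in>J. prob (X j -` A j \<inter> space M))"
    using assms False by (intro indep_varsD[OF indep]) auto
  also have "\<dots> = (\<Prod>j\<in>J. measure \<nu> (A j))"
  proof (rule prod.cong)
    fix j assume "j \<in> J"
    moreover have "X j -` A j \<inter> space M = {\<omega>\<in>space M. X j \<omega> \<in> A j}" by auto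
    ultimately show "prob (X j -` A j \<inter> space M) = measure \<nu> (A j)"
      using assms prob_X[of j "A j"] by auto
  qed simp
  finally show ?thesis .
qed (simp add: prob_space)

text \<open>
  Conditionally on \<open>X i = x\<close>, the other points are independent and each misses \<open>I x\<close> with
  probability at most \<open>1 - w \<le> exp (- w)\<close>. The conditioning is Fubini's theorem for the joint law
  of \<open>X i\<close> and the vector of the other points.
\<close>
lemma prob_empty_window_le:
  assumes i: "i \<ge> 1" and J: "finite J" "J \<subseteq> {1..}" "i \<notin> J"
    and C [measurable]: "C \<in> sets borel"
    and I [measurable]: "{(x, y). y \<in> I x} \<in> sets (borel \<Otimes>\<^sub>M borel)"
    and w: "\<And>x. x \<in> C \<Longrightarrow> w \<le> measure \<nu> (I x)"
  shows "prob {\<omega>\<in>space M. X i \<omega> \<in> C \<and> (\<forall>j\<in>J. X j \<omega> \<notin> I (X i \<omega>))} \<le> measure \<nu> C * exp (- w * real (card J))"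
proof -
  let ?P = "\<lambda>J. PiM J (\<lambda>_. borel :: real measure)"
  \<comment> \<open>\<open>indep_var\<close> relates two variables of the same type, hence the one-point vector for \<open>X i\<close>.\<close>
  define Y where "Y = (\<lambda>J \<omega>. \<lambda>j\<in>J. X j \<omega>)"
  define E where "E = {z \<in> space (?P {i} \<Otimes>\<^sub>M ?P J). fst z i \<in> C \<and> (\<forall>j\<in>J. snd z j \<notin> I (fst z i))}"
  have "indep_var (?P {i}) (Y {i}) (?P J) (Y J)"
    unfolding Y_def using i J by (intro indep_var_restrict[OF indep]) auto
  then have [measurable]: "Y {i} \<in> measurable M (?P {i})" "Y J \<in> measurable M (?P J)"
    and joint: "distr M (?P {i} \<Otimes>\<^sub>M ?P J) (\<lambda>x. (Y {i} x, Y J x)) = distr M (?P {i}) (Y {i}) \<Otimes>\<^sub>M distr M (?P J) (Y J)"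
    by (auto simp: indep_var_distribution_eq)
  have I': "{z \<in> space (?P {i} \<Otimes>\<^sub>M ?P J). snd z j \<in> I (fst z i)} \<in> sets (?P {i} \<Otimes>\<^sub>M ?P J)" if [measurable]: "j \<in> J" for j
  proof -
    have "(\<lambda>z. (fst z i, snd z j)) \<in> measurable (?P {i} \<Otimes>\<^sub>M ?P J) (borel \<Otimes>\<^sub>M borel)" by measurable
    from measurable_sets[OF this I] show ?thesis
      by (rule back_subst[of "\<lambda>A. A \<in> _"]) auto
  qed
  have "{z \<in> space (?P {i} \<Otimes>\<^sub>M ?P J). fst z i \<in> C} \<in> sets (?P {i} \<Otimes>\<^sub>M ?P J)" by measurable
  then have E [measurable]: "E \<in> sets (?P {i} \<Otimes>\<^sub>M ?P J)"
    unfolding E_def using J I' by (intro sets.sets_Collect_conj sets.sets_Collect_finite_All sets.sets_Collect_neg) auto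
  interpret Y: prob_space "distr M (?P J) (Y J)" by (rule prob_space_distr) simp
  have Isec: "I x \<in> sets borel" for x
    using sets_Pair1[OF I, of x] by (simp add: vimage_def)
  have sec: "emeasure (distr M (?P J) (Y J)) (Pair u -` E) \<le> ennreal (exp (- w * real (card J))) * indicator C (u i)" for u
  proof (cases "u \<in> space (?P {i}) \<and> u i \<in> C")
    case True
    have "emeasure (distr M (?P J) (Y J)) (Pair u -` E) = emeasure M (Y J -` (Pair u -` E) \<inter> space M)"
      by (intro emeasure_distr) (auto intro: sets_Pair1)
    also have "Y J -` (Pair u -` E) \<inter> space M = {\<omega>\<in>space M. \<forall>j\<in>J. X j \<omega> \<in> - I (u i)}"
      using True by (auto simp: E_def Y_def space_pair_measure space_PiM)
    also have "emeasure M \<dots> = ennreal (\<Prod>j\<in>J. measure \<nu> (- I (u i)))"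
      using J Isec by (subst emeasure_eq_measure, subst prob_all_in) auto
    also have "\<dots> \<le> ennreal (\<Prod>j\<in>J. exp (- w))"
    proof (intro ennreal_leI prod_mono conjI measure_nonneg)
      interpret \<nu>: prob_space \<nu> by (rule law)
      have "measure \<nu> (- I (u i)) = 1 - measure \<nu> (I (u i))"
        using \<nu>.prob_compl[of "I (u i)"] Isec law by (simp add: Compl_eq_Diff_UNIV)
      also have "\<dots> \<le> 1 + - w" using w[of "u i"] True by simp
      also have "\<dots> \<le> exp (- w)" by (rule exp_ge_add_one_self)
      finally show "measure \<nu> (- I (u i)) \<le> exp (- w)" .
    qed
    finally show ?thesis using True by (simp add: exp_of_nat2_mult[symmetric])
  next
    case False
    then have "Pair u -` E = {}" by (auto simp: E_def space_pair_measure)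
    then show ?thesis by simp
  qed
  have "ennreal (prob {\<omega>\<in>space M. X i \<omega> \<in> C \<and> (\<forall>j\<in>J. X j \<omega> \<notin> I (X i \<omega>))}) = emeasure M ((\<lambda>x. (Y {i} x, Y J x)) -` E \<inter> space M)"
    unfolding emeasure_eq_measure
    by (intro arg_cong[where f="\<lambda>A. ennreal (prob A)"]) (auto simp: E_def Y_def space_pair_measure space_PiM)
  also have "\<dots> = emeasure (distr M (?P {i}) (Y {i}) \<Otimes>\<^sub>M distr M (?P J) (Y J)) E"
    unfolding joint[symmetric] by (intro emeasure_distr[symmetric]) auto
  also have "\<dots> = (\<integral>\<^sup>+u. emeasure (distr M (?P J) (Y J)) (Pair u -` E) \<partial>distr M (?P {i}) (Y {i}))"
    by (rule Y.emeasure_pair_measure_alt) (simp cong: sets_pair_measure_cong)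
  also have "\<dots> \<le> (\<integral>\<^sup>+u. ennreal (exp (- w * real (card J))) * indicator C (u i) \<partial>distr M (?P {i}) (Y {i}))"
    by (intro nn_integral_mono sec)
  also have "\<dots> = (\<integral>\<^sup>+\<omega>. ennreal (exp (- w * real (card J))) * indicator C (Y {i} \<omega> i) \<partial>M)"
    by (rule nn_integral_distr) measurable
  also have "\<dots> = (\<integral>\<^sup>+\<omega>. ennreal (exp (- w * real (card J))) * indicator {\<omega>\<in>space M. X i \<omega> \<in> C} \<omega> \<partial>M)"
    by (intro nn_integral_cong) (auto simp: Y_def indicator_def)
  also have "\<dots> = ennreal (exp (- w * real (card J))) * emeasure M {\<omega>\<in>space M. X i \<omega> \<in> C}"
    using i by (intro nn_integral_cmult_indicator) measurable
  also have "\<dots> = ennreal (measure \<nu> C * exp (- w * real (card J)))"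
    using prob_X[OF i C] by (simp add: emeasure_eq_measure ennreal_mult'' mult.commute)
  finally show ?thesis by (subst (asm) ennreal_le_iff) auto
qed

section \<open>Windows that contain another point\<close>

text \<open>
  The Borel-Cantelli lemma over blocks. Within a block, the points \<open>i\<close> whose windows are considered
  range over all points that can occur, while the point that hits the window is sought among the first
  \<open>k\<^sup>m\<close> points, which are present throughout the block.
\<close>
lemma AE_eventually_window_hit:
  assumes C [measurable]: "\<And>k. C k \<in> sets borel"
    and I: "\<And>k. {(x, y). y \<in> I k x} \<in> sets (borel \<Otimes>\<^sub>M borel)"
    and w: "\<And>k. 0 \<le> w k" "eventually (\<lambda>k. \<forall>x\<in>C k. w k \<le> measure \<nu> (I k x)) sequentially"
    and sum: "summable (\<lambda>k. real (Suc k ^ m) * measure \<nu> (C k) * exp (- (real (k ^ m) - 1) * w k))"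
  shows "AE \<omega> in M. eventually (\<lambda>k. \<forall>n\<in>{k ^ m..<Suc k ^ m}. \<forall>i\<in>{1..n}. X i \<omega> \<in> C k \<longrightarrow>
           (\<exists>j\<in>{1..n} - {i}. X j \<omega> \<in> I k (X i \<omega>))) sequentially"
proof -
  define B where "B = (\<lambda>k i. {\<omega>\<in>space M. X i \<omega> \<in> C k \<and> (\<forall>j\<in>{1..k ^ m} - {i}. X j \<omega> \<notin> I k (X i \<omega>))})"
  have B [measurable]: "B k i \<in> events" if "i \<ge> 1" for k i
  proof -
    have "{\<omega>\<in>space M. X j \<omega> \<in> I k (X i \<omega>)} \<in> events" if "j \<ge> 1" for j
    proof -
      have "(\<lambda>\<omega>. (X i \<omega>, X j \<omega>)) -` {(x, y). y \<in> I k x} \<inter> space M \<in> events"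
        using \<open>i \<ge> 1\<close> \<open>j \<ge> 1\<close> I by (intro measurable_sets[of _ M "borel \<Otimes>\<^sub>M borel"]) measurable
      also have "(\<lambda>\<omega>. (X i \<omega>, X j \<omega>)) -` {(x, y). y \<in> I k x} \<inter> space M = {\<omega>\<in>space M. X j \<omega> \<in> I k (X i \<omega>)}" by auto
      finally show ?thesis .
    qed
    then show ?thesis unfolding B_def using that
      by (intro sets.sets_Collect_conj sets.sets_Collect_finite_All sets.sets_Collect_neg) auto
  qed
  have "prob (\<Union>i\<in>{1..Suc k ^ m}. B k i) \<le> real (Suc k ^ m) * measure \<nu> (C k) * exp (- (real (k ^ m) - 1) * w k)"
    if k: "\<forall>x\<in>C k. w k \<le> measure \<nu> (I k x)" for k
  proof -
    have "prob (\<Union>i\<in>{1..Suc k ^ m}. B k i) \<le> (\<Sum>i\<in>{1..Suc k ^ m}. prob (B k i))"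
      by (intro finite_measure_subadditive_finite) auto
    also have "\<dots> \<le> (\<Sum>i\<in>{1..Suc k ^ m}. measure \<nu> (C k) * exp (- (real (k ^ m) - 1) * w k))"
    proof (intro sum_mono)
      fix i assume i: "i \<in> {1..Suc k ^ m}"
      have "prob (B k i) \<le> measure \<nu> (C k) * exp (- w k * real (card ({1..k ^ m} - {i})))"
        unfolding B_def using i k I by (intro prob_empty_window_le) auto
      also have "k ^ m \<le> card ({1..k ^ m} - {i}) + 1"
        using diff_card_le_card_Diff[of "{i}" "{1..k ^ m}"] by simp
      then have "real (k ^ m) \<le> real (card ({1..k ^ m} - {i}) + 1)" by (simp only: of_nat_le_iff)
      then have "real (k ^ m) - 1 \<le> real (card ({1..k ^ m} - {i}))" by (simp del: of_nat_power)
      then have "(real (k ^ m) - 1) * w k \<le> real (card ({1..k ^ m} - {i})) * w k"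
        using w(1)[of k] by (rule mult_right_mono)
      then have "exp (- w k * real (card ({1..k ^ m} - {i}))) \<le> exp (- (real (k ^ m) - 1) * w k)"
        by (simp add: algebra_simps del: of_nat_power)
      finally show "prob (B k i) \<le> measure \<nu> (C k) * exp (- (real (k ^ m) - 1) * w k)"
        by (simp add: mult_left_mono)
    qed
    finally show ?thesis by simp
  qed
  then have "eventually (\<lambda>k. norm (prob (\<Union>i\<in>{1..Suc k ^ m}. B k i)) \<le> real (Suc k ^ m) * measure \<nu> (C k) * exp (- (real (k ^ m) - 1) * w k)) sequentially"
    using w(2) by (auto elim: eventually_mono)
  from summable_comparison_test_ev[OF this sum]
  have "AE \<omega> in M. eventually (\<lambda>k. \<omega> \<in> space M - (\<Union>i\<in>{1..Suc k ^ m}. B k i)) sequentially"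
    by (intro borel_cantelli_AE1) (auto simp: emeasure_eq_measure)
  then show ?thesis
  proof (rule AE_mp[OF _ AE_I2], intro impI)
    fix \<omega> assume "\<omega> \<in> space M" "eventually (\<lambda>k. \<omega> \<in> space M - (\<Union>i\<in>{1..Suc k ^ m}. B k i)) sequentially"
    from this(2) show "eventually (\<lambda>k. \<forall>n\<in>{k ^ m..<Suc k ^ m}. \<forall>i\<in>{1..n}. X i \<omega> \<in> C k \<longrightarrow>
           (\<exists>j\<in>{1..n} - {i}. X j \<omega> \<in> I k (X i \<omega>))) sequentially"
    proof eventually_elim
      case (elim k)
      show ?case
      proof (intro ballI impI)
        fix n i assume n: "n \<in> {k ^ m..<Suc k ^ m}" and i: "i \<in> {1..n}" "X i \<omega> \<in> C k"
        have "i \<in> {1..Suc k ^ m}" using n i by auto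
        then have "\<omega> \<notin> B k i" using elim by blast
        moreover have "\<omega> \<in> space M" using elim by simp
        ultimately have "\<exists>j\<in>{1..k ^ m} - {i}. X j \<omega> \<in> I k (X i \<omega>)"
          using i(2) unfolding B_def by simp
        then obtain j where "j \<in> {1..k ^ m} - {i}" "X j \<omega> \<in> I k (X i \<omega>)" ..
        then show "\<exists>j\<in>{1..n} - {i}. X j \<omega> \<in> I k (X i \<omega>)" using n by (intro bexI[of _ j]) auto
      qed
    qed
  qed
qed

text \<open>
  The window is taken without the point \<open>X i\<close> itself. For one-sided windows this yields a point
  strictly to the right of \<open>X i\<close>, as is needed for connectivity.
\<close>
lemma AE_eventually_neighbour_interior:
  assumes f: "0 < f0"
    and lower: "\<And>B. B \<in> sets borel \<Longrightarrow> B \<subseteq> {0..T} \<Longrightarrow> f0 * measure lborel B \<le> measure \<nu> B"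
    and \<alpha>\<beta>: "0 \<le> \<alpha>" "0 \<le> \<beta>" "1 < (\<alpha> + \<beta>) * f0"
  shows "AE \<omega> in M. eventually (\<lambda>n. \<forall>i\<in>{1..n}.
           0 \<le> X i \<omega> - \<alpha> * (ln n / n) \<longrightarrow> X i \<omega> + \<beta> * (ln n / n) \<le> T \<longrightarrow>
           (\<exists>j\<in>{1..n} - {i}. X j \<omega> \<in> {X i \<omega> - \<alpha> * (ln n / n)..X i \<omega> + \<beta> * (ln n / n)} - {X i \<omega>})) sequentially"
proof -
  interpret \<nu>: prob_space \<nu> by (rule law)
  define \<theta> where "\<theta> = (\<alpha> + \<beta>) * f0"
  have \<theta>: "\<theta> > 1" using \<alpha>\<beta> by (simp add: \<theta>_def)
  obtain m :: nat where m: "real m * (\<theta> - 1) \<ge> 4"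
  proof -
    obtain m :: nat where "4 / (\<theta> - 1) \<le> real m" using real_arch_simple by blast
    then show thesis using \<theta> by (intro that[of m]) (simp add: field_simps)
  qed
  then have m1: "m \<ge> 1" by (cases m) auto
  define l where "l = (\<lambda>k. ln (real (k ^ m)) / real (Suc k ^ m))"
  have l: "l k \<ge> 0" for k
  proof (cases "k = 0")
    case True
    then show ?thesis using m1 by (simp add: l_def power_0_left)
  next
    case False
    then show ?thesis unfolding l_def by (intro divide_nonneg_nonneg ln_ge_zero) auto
  qed
  define C where "C = (\<lambda>k. {\<alpha> * l k..T - \<beta> * l k})"
  define I where "I = (\<lambda>k x. {x - \<alpha> * l k..x + \<beta> * l k} - {x})"
  have "AE \<omega> in M. eventually (\<lambda>k. \<forall>n\<in>{k ^ m..<Suc k ^ m}. \<forall>i\<in>{1..n}. X i \<omega> \<in> C k \<longrightarrow>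
           (\<exists>j\<in>{1..n} - {i}. X j \<omega> \<in> I k (X i \<omega>))) sequentially"
  proof (rule AE_eventually_window_hit[where w="\<lambda>k. \<theta> * l k"])
    show "C k \<in> sets borel" for k by (simp add: C_def)
    show "{(x, y). y \<in> I k x} \<in> sets (borel \<Otimes>\<^sub>M borel)" for k
    proof -
      have "{z \<in> space (borel \<Otimes>\<^sub>M borel). snd z \<in> I k (fst z)} \<in> sets (borel \<Otimes>\<^sub>M borel)"
        unfolding I_def by simp measurable
      then show ?thesis by (rule back_subst[of "\<lambda>A. A \<in> _"]) (auto simp: space_pair_measure)
    qed
    show "0 \<le> \<theta> * l k" for k using l[of k] \<theta> by simp
    show "eventually (\<lambda>k. \<forall>x\<in>C k. \<theta> * l k \<le> measure \<nu> (I k x)) sequentially"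
    proof (intro always_eventually allI ballI)
      fix k x assume x: "x \<in> C k"
      have ab: "0 \<le> \<alpha> * l k" "0 \<le> \<beta> * l k" using \<alpha>\<beta> l by auto
      have "measure lborel (I k x) = measure lborel {x - \<alpha> * l k..x + \<beta> * l k}"
        unfolding I_def by (intro measure_Diff_null_set) auto
      then have "measure lborel (I k x) = (\<alpha> + \<beta>) * l k" using ab by (simp add: algebra_simps)
      moreover have "f0 * measure lborel (I k x) \<le> measure \<nu> (I k x)"
        using x ab by (intro lower) (auto simp: I_def C_def)
      ultimately show "\<theta> * l k \<le> measure \<nu> (I k x)" by (simp add: \<theta>_def mult_ac)
    qed
    show "summable (\<lambda>k. real (Suc k ^ m) * measure \<nu> (C k) * exp (- (real (k ^ m) - 1) * (\<theta> * l k)))"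
    proof (rule summable_comparison_test')
      show "summable (\<lambda>k. real (Suc k ^ m) * exp (- (real (k ^ m) - 1) * (\<theta> * l k)))"
        unfolding l_def by (rule summable_blocks_interior[OF \<theta> m])
      show "norm (real (Suc k ^ m) * measure \<nu> (C k) * exp (- (real (k ^ m) - 1) * (\<theta> * l k)))
          \<le> real (Suc k ^ m) * exp (- (real (k ^ m) - 1) * (\<theta> * l k))" for k
      proof -
        have "real (Suc k ^ m) * measure \<nu> (C k) \<le> real (Suc k ^ m) * 1" by (intro mult_left_mono) auto
        then show ?thesis by (simp add: abs_mult mult_right_mono del: of_nat_power)
      qed
    qed
  qed
  then show ?thesis
  proof (rule AE_mp[OF _ AE_I2], intro impI)
    fix \<omega> assume "eventually (\<lambda>k. \<forall>n\<in>{k ^ m..<Suc k ^ m}. \<forall>i\<in>{1..n}. X i \<omega> \<in> C k \<longrightarrow>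
           (\<exists>j\<in>{1..n} - {i}. X j \<omega> \<in> I k (X i \<omega>))) sequentially"
    then have "eventually (\<lambda>k. \<forall>n\<in>{k ^ m..<Suc k ^ m}. \<forall>i\<in>{1..n}.
           0 \<le> X i \<omega> - \<alpha> * (ln n / n) \<longrightarrow> X i \<omega> + \<beta> * (ln n / n) \<le> T \<longrightarrow>
           (\<exists>j\<in>{1..n} - {i}. X j \<omega> \<in> {X i \<omega> - \<alpha> * (ln n / n)..X i \<omega> + \<beta> * (ln n / n)} - {X i \<omega>})) sequentially"
      using eventually_ge_at_top[of 1]
    proof eventually_elim
      case (elim k)
      note hit = elim(1) and k = elim(2)
      show ?case
      proof (intro ballI impI)
        fix n i
        assume n: "n \<in> {k ^ m..<Suc k ^ m}" and i: "i \<in> {1..n}"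
          and win: "0 \<le> X i \<omega> - \<alpha> * (ln n / n)" "X i \<omega> + \<beta> * (ln n / n) \<le> T"
        have "l k \<le> ln n / n" unfolding l_def by (rule block_ln_over_le[OF n k])
        note ll = mult_left_mono[OF this \<alpha>\<beta>(1)] mult_left_mono[OF this \<alpha>\<beta>(2)]
        then have "X i \<omega> \<in> C k" using win by (auto simp: C_def)
        then obtain j where "j \<in> {1..n} - {i}" "X j \<omega> \<in> I k (X i \<omega>)" using hit n i by blast
        then show "\<exists>j\<in>{1..n} - {i}. X j \<omega> \<in> {X i \<omega> - \<alpha> * (ln n / n)..X i \<omega> + \<beta> * (ln n / n)} - {X i \<omega>}"
          using ll by (intro bexI[of _ j]) (auto simp: I_def)
      qed
    qed
    then show "eventually (\<lambda>n. \<forall>i\<in>{1..n}.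
           0 \<le> X i \<omega> - \<alpha> * (ln n / n) \<longrightarrow> X i \<omega> + \<beta> * (ln n / n) \<le> T \<longrightarrow>
           (\<exists>j\<in>{1..n} - {i}. X j \<omega> \<in> {X i \<omega> - \<alpha> * (ln n / n)..X i \<omega> + \<beta> * (ln n / n)} - {X i \<omega>})) sequentially"
      by (rule eventually_of_eventually_blocks[OF m1])
  qed
qed

text \<open>
  A point near the endpoint \<open>e\<close> looks for a neighbour on the side away from \<open>e\<close>, where a window of
  length \<open>\<rho> ln n / n\<close> stays inside \<open>[0, T]\<close>.
\<close>
lemma AE_eventually_neighbour_boundary:
  assumes f: "0 < f0" and T: "0 < T" and e: "e = 0 \<or> e = T"
    and lower: "\<And>B. B \<in> sets borel \<Longrightarrow> B \<subseteq> {0..T} \<Longrightarrow> f0 * measure lborel B \<le> measure \<nu> B"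
    and upper: "\<And>B. B \<in> sets borel \<Longrightarrow> B \<subseteq> {0..T} \<Longrightarrow> measure \<nu> B \<le> f1 * measure lborel B"
    and \<rho>: "0 < \<rho>"
  shows "AE \<omega> in M. eventually (\<lambda>n. \<forall>i\<in>{1..n}.
           X i \<omega> \<in> {0..T} \<longrightarrow> \<bar>X i \<omega> - e\<bar> \<le> \<rho> * (ln n / n) \<longrightarrow>
           (\<exists>j\<in>{1..n} - {i}. \<bar>X i \<omega> - X j \<omega>\<bar> \<le> \<rho> * (ln n / n))) sequentially"
proof -
  interpret \<nu>: prob_space \<nu> by (rule law)
  have "f0 * measure lborel {0..T} \<le> f1 * measure lborel {0..T}"
    using lower[of "{0..T}"] upper[of "{0..T}"] by simp
  then have f1: "0 < f1" using T f by auto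
  define \<theta> where "\<theta> = \<rho> * f0"
  have \<theta>: "\<theta> > 0" using \<rho> f by (simp add: \<theta>_def)
  obtain m :: nat where m: "real m * \<theta> \<ge> 6"
  proof -
    obtain m :: nat where "6 / \<theta> \<le> real m" using real_arch_simple by blast
    then show thesis using \<theta> by (intro that[of m]) (simp add: field_simps)
  qed
  then have m1: "m \<ge> 1" by (cases m) auto
  define l where "l = (\<lambda>k. ln (real (k ^ m)) / real (Suc k ^ m))"
  define U where "U = (\<lambda>k. ln (real (Suc k ^ m)) / real (k ^ m))"
  have l: "l k \<ge> 0" for k
  proof (cases "k = 0")
    case True
    then show ?thesis using m1 by (simp add: l_def power_0_left)
  next
    case False
    then show ?thesis unfolding l_def by (intro divide_nonneg_nonneg ln_ge_zero) auto
  qed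
  have U: "U k \<ge> 0" for k
    unfolding U_def by (intro divide_nonneg_nonneg ln_ge_zero) auto
  have lU: "l k \<le> U k" if "k \<ge> 1" for k
    using block_ln_over_le[of "k ^ m" k m] that m1 by (auto simp: l_def U_def power_strict_mono)
  define C where "C = (\<lambda>k. {x\<in>{0..T}. \<bar>x - e\<bar> \<le> \<rho> * U k})"
  define I where "I = (\<lambda>k x. if e = 0 then {x<..x + \<rho> * l k} else {x - \<rho> * l k..<x})"
  have C_eq: "C k = (if e = 0 then {0..min T (\<rho> * U k)} else {max 0 (T - \<rho> * U k)..T})" for k
    using e T by (auto simp: C_def)
  have "AE \<omega> in M. eventually (\<lambda>k. \<forall>n\<in>{k ^ m..<Suc k ^ m}. \<forall>i\<in>{1..n}. X i \<omega> \<in> C k \<longrightarrow>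
           (\<exists>j\<in>{1..n} - {i}. X j \<omega> \<in> I k (X i \<omega>))) sequentially"
  proof (rule AE_eventually_window_hit[where w="\<lambda>k. \<theta> * l k"])
    show "C k \<in> sets borel" for k by (simp add: C_eq)
    show "{(x, y). y \<in> I k x} \<in> sets (borel \<Otimes>\<^sub>M borel)" for k
    proof -
      have "{z \<in> space (borel \<Otimes>\<^sub>M borel). snd z \<in> I k (fst z)} \<in> sets (borel \<Otimes>\<^sub>M borel)"
        unfolding I_def by (cases "e = 0"; simp; measurable)
      then show ?thesis by (rule back_subst[of "\<lambda>A. A \<in> _"]) (auto simp: space_pair_measure)
    qed
    show "0 \<le> \<theta> * l k" for k using l[of k] \<theta> by simp
    have "U \<longlonglongrightarrow> 0" unfolding U_def by (rule block_threshold_tendsto_0[OF m1])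
    from order_tendstoD(2)[OF tendsto_mult[OF tendsto_const[of \<rho>] this], of "T / 2"]
    have "eventually (\<lambda>k. \<rho> * U k < T / 2) sequentially" using T by simp
    then show "eventually (\<lambda>k. \<forall>x\<in>C k. \<theta> * l k \<le> measure \<nu> (I k x)) sequentially"
      using eventually_ge_at_top[of 1]
    proof eventually_elim
      case (elim k)
      show ?case
      proof
        fix x assume x: "x \<in> C k"
        have "\<rho> * l k \<le> \<rho> * U k" using lU[OF elim(2)] \<rho> by simp
        moreover have "0 \<le> \<rho> * l k" using \<rho> l by simp
        ultimately have "I k x \<subseteq> {0..T}" using x elim(1) e T by (auto simp: I_def C_def)
        then have "f0 * measure lborel (I k x) \<le> measure \<nu> (I k x)" by (intro lower) (auto simp: I_def)
        moreover have "measure lborel (I k x) = \<rho> * l k" using \<open>0 \<le> \<rho> * l k\<close> by (simp add: I_def)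
        ultimately show "\<theta> * l k \<le> measure \<nu> (I k x)" by (simp add: \<theta>_def mult_ac)
      qed
    qed
    show "summable (\<lambda>k. real (Suc k ^ m) * measure \<nu> (C k) * exp (- (real (k ^ m) - 1) * (\<theta> * l k)))"
    proof (rule summable_comparison_test')
      show "summable (\<lambda>k. f1 * \<rho> * (real (Suc k ^ m) * U k * exp (- (real (k ^ m) - 1) * (\<theta> * l k))))"
        unfolding l_def U_def by (intro summable_mult summable_blocks_boundary[OF \<theta> m])
      show "norm (real (Suc k ^ m) * measure \<nu> (C k) * exp (- (real (k ^ m) - 1) * (\<theta> * l k)))
          \<le> f1 * \<rho> * (real (Suc k ^ m) * U k * exp (- (real (k ^ m) - 1) * (\<theta> * l k)))" for k
      proof -
        have "measure \<nu> (C k) \<le> f1 * measure lborel (C k)"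
        proof (rule upper)
          show "C k \<in> sets borel" by (simp add: C_eq)
        qed (auto simp: C_def)
        also have "measure lborel (C k) \<le> \<rho> * U k"
          using T U[of k] \<rho> by (auto simp: C_eq min_def max_def)
        finally have "measure \<nu> (C k) \<le> f1 * (\<rho> * U k)" using f1 by simp
        then have "real (Suc k ^ m) * measure \<nu> (C k) * exp (- (real (k ^ m) - 1) * (\<theta> * l k))
          \<le> real (Suc k ^ m) * (f1 * (\<rho> * U k)) * exp (- (real (k ^ m) - 1) * (\<theta> * l k))"
          by (intro mult_left_mono mult_right_mono) auto
        then show ?thesis by (simp add: abs_mult mult_ac del: of_nat_power)
      qed
    qed
  qed
  then show ?thesis
  proof (rule AE_mp[OF _ AE_I2], intro impI)
    fix \<omega> assume "eventually (\<lambda>k. \<forall>n\<in>{k ^ m..<Suc k ^ m}. \<forall>i\<in>{1..n}. X i \<omega> \<in> C k \<longrightarrow>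
           (\<exists>j\<in>{1..n} - {i}. X j \<omega> \<in> I k (X i \<omega>))) sequentially"
    then have "eventually (\<lambda>k. \<forall>n\<in>{k ^ m..<Suc k ^ m}. \<forall>i\<in>{1..n}.
           X i \<omega> \<in> {0..T} \<longrightarrow> \<bar>X i \<omega> - e\<bar> \<le> \<rho> * (ln n / n) \<longrightarrow>
           (\<exists>j\<in>{1..n} - {i}. \<bar>X i \<omega> - X j \<omega>\<bar> \<le> \<rho> * (ln n / n))) sequentially"
      using eventually_ge_at_top[of 1]
    proof eventually_elim
      case (elim k)
      note hit = elim(1) and k = elim(2)
      show ?case
      proof (intro ballI impI)
        fix n i
        assume n: "n \<in> {k ^ m..<Suc k ^ m}" and i: "i \<in> {1..n}"
          and near: "X i \<omega> \<in> {0..T}" "\<bar>X i \<omega> - e\<bar> \<le> \<rho> * (ln n / n)"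
        have "l k \<le> ln n / n" "ln n / n \<le> U k" unfolding l_def U_def by (rule block_ln_over_le[OF n k])+
        note ll = this[THEN mult_left_mono[OF _ less_imp_le[OF \<rho>]]]
        then have "X i \<omega> \<in> C k" using near by (auto simp: C_def)
        then obtain j where "j \<in> {1..n} - {i}" "X j \<omega> \<in> I k (X i \<omega>)" using hit n i by blast
        then show "\<exists>j\<in>{1..n} - {i}. \<bar>X i \<omega> - X j \<omega>\<bar> \<le> \<rho> * (ln n / n)"
          using ll by (intro bexI[of _ j]) (auto simp: I_def split: if_splits)
      qed
    qed
    then show "eventually (\<lambda>n. \<forall>i\<in>{1..n}.
           X i \<omega> \<in> {0..T} \<longrightarrow> \<bar>X i \<omega> - e\<bar> \<le> \<rho> * (ln n / n) \<longrightarrow>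
           (\<exists>j\<in>{1..n} - {i}. \<bar>X i \<omega> - X j \<omega>\<bar> \<le> \<rho> * (ln n / n))) sequentially"
      by (rule eventually_of_eventually_blocks[OF m1])
  qed
qed

section \<open>Isolated points in sparse regions\<close>

text \<open>
  Consider the events, indexed by a cell and one of the first \<open>N\<close> points, that this point lies in
  the part \<open>mid t\<close> of the cell and is the only one of \<open>N'\<close> points in the cell. Two such events with the same
  cell or the same point exclude each other. Otherwise they are almost independent, because
  \<open>1 - p - p' \<le> (1 - p) (1 - p')\<close> for the probabilities \<open>p, p' \<le> P\<close> of two disjoint cells: the
  second moment bound applies with \<open>C = 1 / (1 - P)\<^sup>2\<close>.
\<close>
lemma prob_no_isolated_le:
  assumes K: "\<And>t. t < K \<Longrightarrow> mid t \<in> sets borel \<and> cell t \<in> sets borel \<and> mid t \<subseteq> cell t"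
    and disj: "\<And>s t. s < K \<Longrightarrow> t < K \<Longrightarrow> s \<noteq> t \<Longrightarrow> cell s \<inter> cell t = {}"
    and q: "0 < q" "\<And>t. t < K \<Longrightarrow> q \<le> measure \<nu> (mid t)"
    and P: "0 \<le> P" "P < 1" "\<And>t. t < K \<Longrightarrow> measure \<nu> (cell t) \<le> P"
    and N: "N \<le> N'" "0 < N" "0 < K"
  shows "prob {\<omega>\<in>space M. \<not> (\<exists>t\<in>{..<K}. \<exists>i\<in>{1..N}. X i \<omega> \<in> mid t \<and> (\<forall>j\<in>{1..N'} - {i}. X j \<omega> \<notin> cell t))}
     \<le> 1 / (real K * real N * q * (1 - P) ^ N') + (1 / (1 - P)\<^sup>2 - 1)"
proof -
  interpret \<nu>: prob_space \<nu> by (rule law)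
  define A where "A = (\<lambda>(t, i) (j :: nat). if j = i then mid t else - cell t)"
  define E where "E = (\<lambda>s. {\<omega>\<in>space M. \<forall>j\<in>{1..N'}. X j \<omega> \<in> A s j})"
  let ?S = "{..<K} \<times> {1..N}"
  have A: "A s j \<in> sets borel" if "s \<in> ?S" for s j
    using that K by (cases s) (auto simp: A_def intro!: borel_comp)
  have inE: "{\<omega>\<in>space M. \<forall>j\<in>{1..N'}. X j \<omega> \<in> F j} \<in> events" if "\<And>j. F j \<in> sets borel" for F
    using that by (intro sets.sets_Collect_finite_All) auto
  have E: "E s \<in> events" if "s \<in> ?S" for s
    unfolding E_def using A[OF that] by (rule inE)
  define p where "p = (\<lambda>t. measure \<nu> (cell t))"
  define c where "c = (\<lambda>t. measure \<nu> (- cell t))"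
  define m where "m = (\<lambda>t. measure \<nu> (mid t))"
  have c: "c t = 1 - p t" "1 - P \<le> c t" "0 \<le> c t" if "t < K" for t
    using that K[OF that] P(3)[OF that] \<nu>.prob_compl[of "cell t"] law by (auto simp: c_def p_def Compl_eq_Diff_UNIV)
  have m: "m t \<ge> 0" "q \<le> m t" if "t < K" for t using q(2)[OF that] by (auto simp: m_def)
  have probE: "prob (E (t, i)) = m t * c t ^ (N' - 1)" if "t < K" "i \<in> {1..N}" for t i
  proof -
    have i: "i \<in> {1..N'}" using that N by auto
    have "prob (E (t, i)) = (\<Prod>j\<in>{1..N'}. measure \<nu> (A (t, i) j))"
      unfolding E_def using that A by (intro prob_all_in) auto
    also have "\<dots> = measure \<nu> (A (t, i) i) * (\<Prod>j\<in>{1..N'} - {i}. measure \<nu> (A (t, i) j))"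
      using i by (intro prod.remove) auto
    also have "(\<Prod>j\<in>{1..N'} - {i}. measure \<nu> (A (t, i) j)) = (\<Prod>j\<in>{1..N'} - {i}. c t)"
      by (intro prod.cong) (auto simp: A_def c_def)
    finally show ?thesis using i by (simp add: A_def m_def)
  qed
  have "prob (space M - (\<Union>s\<in>?S. E s)) \<le> 1 / (real K * real N * q * (1 - P) ^ N') + (1 / (1 - P)\<^sup>2 - 1)"
  proof (rule prob_no_event_le)
    show "finite ?S" by simp
    show "E s \<in> events" if "s \<in> ?S" for s by (rule E[OF that])
    show "0 \<le> 1 / (1 - P)\<^sup>2" by simp
    show "0 < real K * real N * q * (1 - P) ^ N'" using q P N by simp
    have "real K * real N * q * (1 - P) ^ N' = (\<Sum>s\<in>?S. q * (1 - P) ^ N')"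
      by (simp add: card_cartesian_product)
    also have "\<dots> \<le> (\<Sum>s\<in>?S. prob (E s))"
    proof (intro sum_mono)
      fix s assume "s \<in> ?S"
      then obtain t i where s: "s = (t, i)" "t < K" "i \<in> {1..N}" by auto
      have "(1 - P) ^ N' \<le> (1 - P) ^ (N' - 1)" using P by (intro power_decreasing) auto
      also have "\<dots> \<le> c t ^ (N' - 1)" using P c[OF s(2)] by (intro power_mono) auto
      finally show "q * (1 - P) ^ N' \<le> prob (E s)"
        unfolding s(1) probE[OF s(2,3)] using m[OF s(2)] q P by (intro mult_mono) auto
    qed
    finally show "real K * real N * q * (1 - P) ^ N' \<le> (\<Sum>s\<in>?S. prob (E s))" .
    fix s s' assume ss: "s \<in> ?S" "s' \<in> ?S" "s \<noteq> s'"
    obtain t i where s: "s = (t, i)" "t < K" "i \<in> {1..N}" using ss by auto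
    obtain t' i' where s': "s' = (t', i')" "t' < K" "i' \<in> {1..N}" using ss by auto
    have ii: "i \<in> {1..N'}" "i' \<in> {1..N'}" using s s' N by auto
    show "prob (E s \<inter> E s') \<le> 1 / (1 - P)\<^sup>2 * prob (E s) * prob (E s')"
    proof (cases "t \<noteq> t' \<and> i \<noteq> i'")
      case False
      have "E s \<inter> E s' = {}"
      proof (rule ccontr)
        assume "E s \<inter> E s' \<noteq> {}"
        then obtain \<omega> where \<omega>: "\<omega> \<in> E s" "\<omega> \<in> E s'" by auto
        have a: "X j \<omega> \<in> A s j" "X j \<omega> \<in> A s' j" if "j \<in> {1..N'}" for j
          using \<omega> that by (auto simp: E_def)
        have "X i \<omega> \<in> mid t" "X i' \<omega> \<in> mid t'" using a[of i] a[of i'] ii s s' by (auto simp: A_def)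
        moreover have "X i' \<omega> \<in> - cell t" if "i \<noteq> i'" using a[of i'] ii s s' that by (auto simp: A_def)
        ultimately show False using False ss s s' K[of t] K[of t'] disj[of t t'] by auto
      qed
      then show ?thesis by simp
    next
      case True
      define D where "D = (\<lambda>j. if j = i then mid t else if j = i' then mid t' else - (cell t \<union> cell t'))"
      have D: "D j \<in> sets borel" for j using K s s' by (auto simp: D_def intro!: borel_comp simp del: Compl_Un)
      have "prob (E s \<inter> E s') \<le> prob {\<omega>\<in>space M. \<forall>j\<in>{1..N'}. X j \<omega> \<in> D j}"
        using s s' True by (intro finite_measure_mono inE D) (auto simp: E_def A_def D_def split: if_splits)
      also have "\<dots> = (\<Prod>j\<in>{1..N'}. measure \<nu> (D j))"
        using D by (intro prob_all_in) auto
      also have "\<dots> = measure \<nu> (D i) * (measure \<nu> (D i') * (\<Prod>j\<in>{1..N'} - {i} - {i'}. measure \<nu> (D j)))"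
        using ii True by (subst prod.remove[of _ i], simp, simp, subst prod.remove[of _ i']) auto
      also have "(\<Prod>j\<in>{1..N'} - {i} - {i'}. measure \<nu> (D j)) = (\<Prod>j\<in>{1..N'} - {i} - {i'}. measure \<nu> (- (cell t \<union> cell t')))"
        by (intro prod.cong) (auto simp: D_def)
      also have "\<dots> = measure \<nu> (- (cell t \<union> cell t')) ^ (N' - 2)"
      proof -
        have "i' \<in> {1..N'} - {i}" using ii True by simp
        then have "card ({1..N'} - {i} - {i'}) = card {1..N'} - 1 - 1"
          by (simp only: card_Diff_singleton ii(1))
        also have "\<dots> = N' - 2" by simp
        finally show ?thesis by (simp only: prod_constant)
      qed
      also have "measure \<nu> (D i) * (measure \<nu> (D i') * measure \<nu> (- (cell t \<union> cell t')) ^ (N' - 2))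
          \<le> m t * (m t' * (c t * c t') ^ (N' - 2))"
      proof -
        have "measure \<nu> (cell t \<union> cell t') = p t + p t'"
          unfolding p_def using K s s' True disj[of t t'] law by (intro \<nu>.finite_measure_Union) auto
        moreover have "cell t \<union> cell t' \<in> sets borel" using K s s' by auto
        ultimately have "measure \<nu> (- (cell t \<union> cell t')) = 1 - (p t + p t')"
          using \<nu>.prob_compl[of "cell t \<union> cell t'"] law by (simp add: Compl_eq_Diff_UNIV)
        also have "\<dots> \<le> (1 - p t) * (1 - p t')" by (simp add: algebra_simps p_def)
        also have "\<dots> = c t * c t'" using c(1) s s' by simp
        finally have "measure \<nu> (- (cell t \<union> cell t')) ^ (N' - 2) \<le> (c t * c t') ^ (N' - 2)"
          by (intro power_mono) auto
        then show ?thesis using True m s s' by (auto simp: D_def m_def intro!: mult_left_mono)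
      qed
      also have "\<dots> \<le> 1 / (1 - P)\<^sup>2 * (c t * c t') * (m t * (m t' * (c t * c t') ^ (N' - 2)))"
      proof -
        have "(1 - P)\<^sup>2 \<le> c t * c t'"
          using c s s' P unfolding power2_eq_square by (intro mult_mono) auto
        then have "1 \<le> 1 / (1 - P)\<^sup>2 * (c t * c t')" using P by (simp add: field_simps)
        moreover have "0 \<le> m t * (m t' * (c t * c t') ^ (N' - 2))"
          using m c s s' by (intro mult_nonneg_nonneg zero_le_power) auto
        ultimately show ?thesis
          using mult_right_mono[of 1 "1 / (1 - P)\<^sup>2 * (c t * c t')"] by (simp only: mult_1_left)
      qed
      also have "\<dots> = 1 / (1 - P)\<^sup>2 * (m t * c t ^ (N' - 1)) * (m t' * c t' ^ (N' - 1))"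
      proof -
        have "N' \<ge> 2" using ii True by (cases "i = 1") auto
        then have "N' - 1 = Suc (N' - 2)" by simp
        then show ?thesis by (simp add: power_mult_distrib)
      qed
      also have "\<dots> = 1 / (1 - P)\<^sup>2 * prob (E s) * prob (E s')"
        using probE[of t i] probE[of t' i'] s s' by simp
      finally show ?thesis .
    qed
  qed
  moreover have memE: "\<omega> \<in> E (t, i) \<longleftrightarrow> \<omega> \<in> space M \<and> X i \<omega> \<in> mid t \<and> (\<forall>j\<in>{1..N'} - {i}. X j \<omega> \<notin> cell t)"
    if "i \<in> {1..N}" for \<omega> t i
    using that N unfolding E_def A_def by auto
  have "{\<omega>\<in>space M. \<not> (\<exists>t\<in>{..<K}. \<exists>i\<in>{1..N}. X i \<omega> \<in> mid t \<and> (\<forall>j\<in>{1..N'} - {i}. X j \<omega> \<notin> cell t))}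
      = space M - (\<Union>t\<in>{..<K}. \<Union>i\<in>{1..N}. E (t, i))"
    using memE by blast
  moreover have "(\<Union>t\<in>{..<K}. \<Union>i\<in>{1..N}. E (t, i)) = (\<Union>s\<in>?S. E s)" by auto
  ultimately show ?thesis by simp
qed

text \<open>
  The interval \<open>[u, v]\<close> is cut into cells slightly longer than \<open>(\<alpha> + \<beta>) ln n / n\<close>. A point in
  the middle part of a cell has its whole window inside the cell, so it is isolated when it is alone
  there. There are about \<open>n / ln n\<close> cells, and each of them has a single point, lying in its
  middle part, with probability at least of the order of \<open>ln n\<close> times \<open>n\<close> to the power \<open>- \<theta>'\<close>,
  where \<open>\<theta>' < 1\<close>. Hence the expected number of isolated points grows like a positive power
  of \<open>n\<close>.
\<close>
lemma AE_eventually_isolated: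
  assumes uv: "u < v" and f: "0 < f0"
    and lower: "\<And>B. B \<in> sets borel \<Longrightarrow> B \<subseteq> {u..v} \<Longrightarrow> f0 * measure lborel B \<le> measure \<nu> B"
    and upper: "\<And>B. B \<in> sets borel \<Longrightarrow> B \<subseteq> {u..v} \<Longrightarrow> measure \<nu> B \<le> f1 * measure lborel B"
    and \<alpha>\<beta>: "0 \<le> \<alpha>" "0 \<le> \<beta>" "(\<alpha> + \<beta>) * f1 < 1"
  shows "AE \<omega> in M. eventually (\<lambda>n. \<exists>i\<in>{1..n}. X i \<omega> \<in> {u..v} \<and>
           (\<forall>j\<in>{1..n} - {i}. X j \<omega> \<notin> {X i \<omega> - \<alpha> * (ln n / n)..X i \<omega> + \<beta> * (ln n / n)})) sequentially"
proof -
  have "f0 * measure lborel {u..v} \<le> f1 * measure lborel {u..v}"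
    using lower[of "{u..v}"] upper[of "{u..v}"] by simp
  then have f1: "f0 \<le> f1" "0 < f1" using uv f by auto
  \<comment> \<open>In units of \<open>U k\<close>, the middle part of a cell has length \<open>\<eta>\<close> and the cell length \<open>d\<close>. The choice
    makes \<open>d f1\<close> the midpoint of \<open>(\<alpha> + \<beta>) f1\<close> and 1.\<close>
  define \<eta> where "\<eta> = (1 - (\<alpha> + \<beta>) * f1) / (2 * f1)"
  define d where "d = \<alpha> + \<beta> + \<eta>"
  define \<theta> where "\<theta> = d * f1"
  define \<theta>' where "\<theta>' = (1 + \<theta>) / 2"
  have \<eta>: "\<eta> > 0" using \<alpha>\<beta> f1 by (simp add: \<eta>_def)
  have d: "d > 0" using \<eta> \<alpha>\<beta> by (simp add: d_def)
  have "\<theta> = (1 + (\<alpha> + \<beta>) * f1) / 2" using f1 by (simp add: \<theta>_def d_def \<eta>_def field_simps)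
  then have \<theta>: "0 \<le> \<theta>" "\<theta> < \<theta>'" "\<theta>' < 1" using \<alpha>\<beta> d f1 by (simp add: \<theta>_def, simp_all add: \<theta>'_def)
  obtain m where m: "m \<ge> 3" "real m * (1 - \<theta>') \<ge> 2"
  proof -
    obtain m0 :: nat where "2 / (1 - \<theta>') \<le> real m0" using real_arch_simple by blast
    then have "2 \<le> real m0 * (1 - \<theta>')" using \<theta> by (simp add: field_simps)
    also have "\<dots> \<le> real (max m0 3) * (1 - \<theta>')" using \<theta> by (intro mult_right_mono) auto
    finally have "2 \<le> real (max m0 3) * (1 - \<theta>')" .
    then show thesis by (intro that[of "max m0 3"]) auto
  qed
  define U where "U = (\<lambda>k. ln (real (Suc k ^ m)) / real (k ^ m))"
  define K where "K = (\<lambda>k. nat \<lfloor>(v - u) / (d * U k)\<rfloor>)"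
  define cell where "cell = (\<lambda>k t. {u + real t * (d * U k)..<u + real (Suc t) * (d * U k)})"
  define mid where "mid = (\<lambda>k t. {u + real t * (d * U k) + \<alpha> * U k..<u + real t * (d * U k) + (\<alpha> + \<eta>) * U k})"
  define Bad where "Bad = (\<lambda>k. {\<omega>\<in>space M. \<not> (\<exists>t\<in>{..<K k}. \<exists>i\<in>{1..k ^ m}. X i \<omega> \<in> mid k t \<and> (\<forall>j\<in>{1..Suc k ^ m} - {i}. X j \<omega> \<notin> cell k t))})"
  have Bad: "Bad k \<in> events" for k
  proof -
    have "{\<omega>\<in>space M. X i \<omega> \<in> B} \<in> events" if "i \<ge> 1" "B \<in> sets borel" for i B
      using that by measurable
    then have "{\<omega>\<in>space M. \<exists>t\<in>{..<K k}. \<exists>i\<in>{1..k ^ m}. X i \<omega> \<in> mid k t \<and> (\<forall>j\<in>{1..Suc k ^ m} - {i}. X j \<omega> \<notin> cell k t)} \<in> events"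
      unfolding mid_def cell_def
      by (intro sets.sets_Collect_finite_Ex sets.sets_Collect_conj sets.sets_Collect_finite_All sets.sets_Collect_neg) auto
    then show ?thesis unfolding Bad_def by (rule sets.sets_Collect_neg)
  qed
  have Ulim: "U \<longlonglongrightarrow> 0" unfolding U_def using m by (intro block_threshold_tendsto_0) auto
  have Upos: "U k > 0" if "k \<ge> 1" for k
  proof -
    have "1 < Suc k ^ m" using that m by (intro one_less_power) auto
    then have "1 < real (Suc k ^ m)" by (metis of_nat_1 of_nat_less_iff)
    then show ?thesis unfolding U_def using that by (intro divide_pos_pos ln_gt_zero) auto
  qed
  define c where "c = (v - u) * f0 * \<eta> / (2 * d)"
  have c: "c > 0" using uv f \<eta> d by (simp add: c_def)
  have "eventually (\<lambda>k. \<theta> * U k < 1 / 2) sequentially"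
    using order_tendstoD(2)[OF tendsto_mult[OF tendsto_const[of \<theta>] Ulim], of "1/2"] by simp
  moreover have "eventually (\<lambda>k. U k * d < (v - u) / 2) sequentially"
    using order_tendstoD(2)[OF tendsto_mult[OF Ulim tendsto_const[of d]], of "(v - u) / 2"] uv by simp
  moreover have "eventually (\<lambda>k. real k powr (- (real m * \<theta>')) \<le> (1 - \<theta> * U k) ^ (Suc k ^ m)) sequentially"
    unfolding U_def using m by (intro eventually_vacancy_block_ge \<theta>) auto
  ultimately have "eventually (\<lambda>k. norm (prob (Bad k)) \<le> 1 / c * real k powr -2 + 6 * \<theta> * U k) sequentially"
    using eventually_ge_at_top[of 1]
  proof eventually_elim
    case (elim k)
    define P where "P = \<theta> * U k"
    define N where "N = k ^ m"
    define N' where "N' = Suc k ^ m"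
    note U = Upos[OF elim(4)]
    have w: "d * U k > 0" using d U by simp
    have P: "0 \<le> P" "P < 1 / 2" using elim \<theta> U by (auto simp: P_def)
    have N: "N \<le> N'" "0 < N" using elim by (auto simp: N_def N'_def power_mono)
    \<comment> \<open>At least half of \<open>[u, v]\<close> is covered by complete cells.\<close>
    have K1: "(v - u) / (d * U k) - 1 \<le> real (K k)" unfolding K_def by linarith
    have K2: "real (K k) * (d * U k) \<le> v - u"
    proof -
      have "real (K k) \<le> (v - u) / (d * U k)" unfolding K_def using uv w by (simp add: of_nat_nat)
      then show ?thesis using w by (simp add: field_simps)
    qed
    have K3: "(v - u) / 2 \<le> real (K k) * d * U k"
    proof -
      have "(v - u) / 2 \<le> (v - u) - U k * d" using elim(2) by (simp add: field_simps)
      also have "\<dots> = ((v - u) / (d * U k) - 1) * (d * U k)"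
        using d U by (simp add: field_simps)
      also have "\<dots> \<le> real (K k) * (d * U k)" using K1 w by (intro mult_right_mono) auto
      finally show ?thesis by (simp only: mult.assoc)
    qed
    have Kpos: "0 < K k" using K3 uv by (cases "K k") auto
    have sub: "cell k t \<subseteq> {u..v}" "mid k t \<subseteq> cell k t" if "t < K k" for t
    proof -
      have "real (Suc t) * (d * U k) \<le> real (K k) * (d * U k)" using that w by (intro mult_right_mono) auto
      then have "u + real (Suc t) * (d * U k) \<le> v" using K2 by linarith
      moreover have "0 \<le> real t * (d * U k)" using w by simp
      ultimately show "cell k t \<subseteq> {u..v}" by (auto simp: cell_def)
      have "0 \<le> \<alpha> * U k" "0 \<le> \<beta> * U k" using \<alpha>\<beta> U by auto
      then show "mid k t \<subseteq> cell k t"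
        by (auto simp: mid_def cell_def d_def algebra_simps)
    qed
    have "prob (Bad k) \<le> 1 / (real (K k) * real N * (f0 * \<eta> * U k) * (1 - P) ^ N') + (1 / (1 - P)\<^sup>2 - 1)"
      unfolding Bad_def N_def[symmetric] N'_def[symmetric]
    proof (rule prob_no_isolated_le)
      fix t assume t: "t < K k"
      show "mid k t \<in> sets borel \<and> cell k t \<in> sets borel \<and> mid k t \<subseteq> cell k t"
        using sub[OF t] by (auto simp: mid_def cell_def)
      have "f0 * measure lborel (mid k t) \<le> measure \<nu> (mid k t)"
        using sub[OF t] by (intro lower) (auto simp: mid_def)
      moreover have "measure lborel (mid k t) = \<eta> * U k" using \<eta> U by (simp add: mid_def algebra_simps)
      ultimately show "f0 * \<eta> * U k \<le> measure \<nu> (mid k t)" by simp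
      have "measure \<nu> (cell k t) \<le> f1 * measure lborel (cell k t)"
        using sub[OF t] by (intro upper) (auto simp: cell_def)
      moreover have "measure lborel (cell k t) = d * U k" using w by (simp add: cell_def algebra_simps)
      ultimately show "measure \<nu> (cell k t) \<le> P" by (simp add: P_def \<theta>_def mult_ac)
    next
      have *: "cell k s \<inter> cell k t = {}" if "s < t" for s t :: nat
      proof -
        have "real (Suc s) * (d * U k) \<le> real t * (d * U k)" using that w by (intro mult_right_mono) auto
        then show ?thesis by (auto simp: cell_def)
      qed
      fix s t :: nat assume "s \<noteq> t"
      then show "cell k s \<inter> cell k t = {}" using *[of s t] *[of t s] by (cases "s < t") auto
    qed (use P N Kpos f \<eta> U in auto)
    also have "1 / (real (K k) * real N * (f0 * \<eta> * U k) * (1 - P) ^ N') \<le> 1 / (c * real k powr 2)"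
    proof (rule divide_left_mono)
      have "c * real k powr 2 \<le> c * (real k powr m * real k powr (- (real m * \<theta>')))"
        using c m elim(4) by (subst powr_add[symmetric]) (intro mult_left_mono powr_mono, auto simp: algebra_simps)
      also have "\<dots> = c * real N * real k powr (- (real m * \<theta>'))"
        using elim(4) by (simp add: powr_realpow N_def)
      also have "\<dots> \<le> c * real N * (1 - P) ^ N'"
        using c elim(3) by (intro mult_left_mono) (auto simp: N'_def P_def)
      also have "c \<le> real (K k) * (f0 * \<eta> * U k)"
      proof -
        have "(v - u) / 2 * (f0 * \<eta> / d) \<le> real (K k) * d * U k * (f0 * \<eta> / d)"
          using K3 f \<eta> d by (intro mult_right_mono) auto
        then show ?thesis using d by (simp add: c_def mult_ac)
      qed
      then have "c * real N * (1 - P) ^ N' \<le> real (K k) * (f0 * \<eta> * U k) * real N * (1 - P) ^ N'"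
        using P by (intro mult_right_mono) auto
      finally show "c * real k powr 2 \<le> real (K k) * real N * (f0 * \<eta> * U k) * (1 - P) ^ N'"
        by (simp add: mult_ac)
      show "0 < real (K k) * real N * (f0 * \<eta> * U k) * (1 - P) ^ N' * (c * real k powr 2)"
        using P N Kpos f \<eta> U c elim(4) by (intro mult_pos_pos) auto
    qed simp
    also have "1 / (c * real k powr 2) = 1 / c * real k powr -2" by (simp add: powr_minus field_simps)
    also have "1 / (1 - P)\<^sup>2 - 1 \<le> 6 * P"
    proof -
      \<comment> \<open>\<open>(1 + 6 P) (1 - P)\<^sup>2 - 1 = P (1 - 2 P) (4 - 3 P)\<close>\<close>
      have "0 \<le> P * (4 - 11 * P + 6 * P\<^sup>2)"
      proof (intro mult_nonneg_nonneg P)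
        have "0 \<le> (1 - 2 * P) * (4 - 3 * P)" using P by (intro mult_nonneg_nonneg) auto
        then show "0 \<le> 4 - 11 * P + 6 * P\<^sup>2" by (simp add: power2_eq_square algebra_simps)
      qed
      then have "1 \<le> (1 + 6 * P) * (1 - P)\<^sup>2" by (simp add: power2_eq_square algebra_simps)
      then show ?thesis using P by (simp add: field_simps)
    qed
    finally show ?case by (simp add: P_def mult_ac)
  qed
  moreover have "summable (\<lambda>k. 1 / c * real k powr -2 + 6 * \<theta> * U k)"
    unfolding U_def by (intro summable_add summable_mult summable_block_threshold m) (simp add: summable_real_powr_iff)
  ultimately have "summable (\<lambda>k. prob (Bad k))" by (rule summable_comparison_test_ev)
  then have "AE \<omega> in M. eventually (\<lambda>k. \<omega> \<in> space M - Bad k) sequentially"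
    using Bad by (intro borel_cantelli_AE1) (auto simp: emeasure_eq_measure)
  then show ?thesis
  proof (rule AE_mp[OF _ AE_I2], intro impI)
    fix \<omega> assume "\<omega> \<in> space M" and "eventually (\<lambda>k. \<omega> \<in> space M - Bad k) sequentially"
    from this(2) have "eventually (\<lambda>k. \<forall>n\<in>{k ^ m..<Suc k ^ m}. \<exists>i\<in>{1..n}. X i \<omega> \<in> {u..v} \<and>
           (\<forall>j\<in>{1..n} - {i}. X j \<omega> \<notin> {X i \<omega> - \<alpha> * (ln n / n)..X i \<omega> + \<beta> * (ln n / n)})) sequentially"
      using eventually_ge_at_top[of 1]
    proof eventually_elim
      case (elim k)
      note U = Upos[OF elim(2)]
      have w: "d * U k > 0" using d U by simp
      obtain t i where t: "t \<in> {..<K k}" and i: "i \<in> {1..k ^ m}" "X i \<omega> \<in> mid k t"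
        and j: "\<And>j. j \<in> {1..Suc k ^ m} - {i} \<Longrightarrow> X j \<omega> \<notin> cell k t"
        using elim(1) unfolding Bad_def by blast
      show ?case
      proof (intro ballI)
        fix n assume n: "n \<in> {k ^ m..<Suc k ^ m}"
        have LU: "ln (real n) / real n \<le> U k" unfolding U_def by (rule block_ln_over_le[OF n elim(2)])
        note L = mult_left_mono[OF LU \<alpha>\<beta>(1)] mult_left_mono[OF LU \<alpha>\<beta>(2)]
        have "real (Suc t) * (d * U k) \<le> real (K k) * (d * U k)" using t w
          by (intro mult_right_mono) auto
        moreover have "real (K k) * (d * U k) \<le> v - u"
        proof -
          have "real (K k) \<le> (v - u) / (d * U k)" unfolding K_def using uv w by (simp add: of_nat_nat)
          then show ?thesis using w by (simp add: field_simps)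
        qed
        ultimately have tv: "u + real (Suc t) * (d * U k) \<le> v" by linarith
        have ab: "0 \<le> \<alpha> * U k" "0 \<le> \<beta> * U k" "0 \<le> real t * (d * U k)" using \<alpha>\<beta> U w by auto
        have Suct: "u + real (Suc t) * (d * U k) = u + real t * (d * U k) + (\<alpha> + \<eta>) * U k + \<beta> * U k"
          by (simp add: d_def algebra_simps)
        have Xi: "u + real t * (d * U k) + \<alpha> * U k \<le> X i \<omega>" "X i \<omega> < u + real t * (d * U k) + (\<alpha> + \<eta>) * U k"
          using i(2) by (auto simp: mid_def)
        have win: "{X i \<omega> - \<alpha> * (ln n / n)..X i \<omega> + \<beta> * (ln n / n)} \<subseteq> cell k t"
          unfolding cell_def Suct using L Xi by auto
        show "\<exists>i\<in>{1..n}. X i \<omega> \<in> {u..v} \<and>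
           (\<forall>j\<in>{1..n} - {i}. X j \<omega> \<notin> {X i \<omega> - \<alpha> * (ln n / n)..X i \<omega> + \<beta> * (ln n / n)})"
        proof (intro bexI conjI ballI)
          show "i \<in> {1..n}" using i n by auto
          show "X i \<omega> \<in> {u..v}" using Xi ab tv unfolding Suct by auto
          fix j' assume "j' \<in> {1..n} - {i}"
          then have "j' \<in> {1..Suc k ^ m} - {i}" using n by auto
          from j[OF this] show "X j' \<omega> \<notin> {X i \<omega> - \<alpha> * (ln n / n)..X i \<omega> + \<beta> * (ln n / n)}" using win by blast
        qed
      qed
    qed
    then show "eventually (\<lambda>n. \<exists>i\<in>{1..n}. X i \<omega> \<in> {u..v} \<and>
           (\<forall>j\<in>{1..n} - {i}. X j \<omega> \<notin> {X i \<omega> - \<alpha> * (ln n / n)..X i \<omega> + \<beta> * (ln n / n)})) sequentially"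
      by (rule eventually_of_eventually_blocks[rotated]) (use m in simp)
  qed
qed

end

section \<open>Limits for a density that is smallest at the right endpoint\<close>

lemma AE_tendsto_of_ratio_bounds:
  fixes f :: "nat \<Rightarrow> 'a \<Rightarrow> real"
  assumes A: "A > 0"
    and ev: "\<And>\<epsilon>. 0 < \<epsilon> \<Longrightarrow> \<epsilon> < 1 \<Longrightarrow>
      AE \<omega> in M. eventually (\<lambda>n. (1 - \<epsilon>) * A \<le> f n \<omega> \<and> f n \<omega> \<le> (1 + \<epsilon>) * A) sequentially"
  shows "AE \<omega> in M. (\<lambda>n. f n \<omega>) \<longlonglongrightarrow> A"
proof -
  have "AE \<omega> in M. \<forall>q::nat. eventually (\<lambda>n. (1 - 1 / real (q + 2)) * A \<le> f n \<omega> \<and> f n \<omega> \<le> (1 + 1 / real (q + 2)) * A) sequentially"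
    by (subst AE_all_countable) (intro allI ev, auto)
  then show ?thesis
  proof (rule AE_mp[OF _ AE_I2], intro impI)
    fix \<omega> assume *: "\<forall>q::nat. eventually (\<lambda>n. (1 - 1 / real (q + 2)) * A \<le> f n \<omega> \<and> f n \<omega> \<le> (1 + 1 / real (q + 2)) * A) sequentially"
    show "(\<lambda>n. f n \<omega>) \<longlonglongrightarrow> A"
    proof (rule tendstoI)
      fix r :: real assume r: "r > 0"
      obtain q :: nat where q: "A / r < real q" using reals_Archimedean2 by blast
      then have "A < real (q + 2) * r" using r by (simp add: field_simps)
      then have "1 / real (q + 2) * A < r" by (simp add: field_simps)
      moreover have "eventually (\<lambda>n. (1 - 1 / real (q + 2)) * A \<le> f n \<omega> \<and> f n \<omega> \<le> (1 + 1 / real (q + 2)) * A) sequentially"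
        using * by blast
      ultimately show "eventually (\<lambda>n. dist (f n \<omega>) A < r) sequentially"
        by (auto elim!: eventually_mono simp: dist_real_def left_diff_distrib distrib_right abs_less_iff simp del: of_nat_add)
    qed
  qed
qed

lemma measure_density_lborel_bounds:
  fixes g :: "real \<Rightarrow> real"
  assumes g: "g \<in> borel_measurable borel" and fin: "finite_measure (density lborel (\<lambda>x. ennreal (g x)))"
    and B: "B \<in> sets borel" "B \<subseteq> {u..v}" and a: "0 \<le> a"
  shows "(\<And>x. x \<in> B \<Longrightarrow> a \<le> g x) \<Longrightarrow> a * measure lborel B \<le> measure (density lborel (\<lambda>x. ennreal (g x))) B"
    and "(\<And>x. x \<in> B \<Longrightarrow> g x \<le> a) \<Longrightarrow> measure (density lborel (\<lambda>x. ennreal (g x))) B \<le> a * measure lborel B"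
proof -
  interpret finite_measure "density lborel (\<lambda>x. ennreal (g x))" by (rule fin)
  have "emeasure lborel B \<le> emeasure lborel {u..v}" using B by (intro emeasure_mono) auto
  also have "\<dots> < \<infinity>" by (simp add: emeasure_lborel_Icc_eq)
  finally have "emeasure lborel B = ennreal (measure lborel B)" by (intro emeasure_eq_ennreal_measure) auto
  then have const: "(\<integral>\<^sup>+x. ennreal a * indicator B x \<partial>lborel) = ennreal (a * measure lborel B)"
    using B a by (simp add: nn_integral_cmult_indicator ennreal_mult')
  have dens: "(\<integral>\<^sup>+x. ennreal (g x) * indicator B x \<partial>lborel) = ennreal (measure (density lborel (\<lambda>x. ennreal (g x))) B)"
    using g B by (subst emeasure_density[symmetric]) (auto simp: emeasure_eq_measure)
  show "a * measure lborel B \<le> measure (density lborel (\<lambda>x. ennreal (g x))) B" if "\<And>x. x \<in> B \<Longrightarrow> a \<le> g x"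
  proof -
    have "(\<integral>\<^sup>+x. ennreal a * indicator B x \<partial>lborel) \<le> (\<integral>\<^sup>+x. ennreal (g x) * indicator B x \<partial>lborel)"
      using that by (intro nn_integral_mono) (auto simp: indicator_def intro: ennreal_leI)
    then show ?thesis unfolding const dens by (subst (asm) ennreal_le_iff) auto
  qed
  show "measure (density lborel (\<lambda>x. ennreal (g x))) B \<le> a * measure lborel B" if "\<And>x. x \<in> B \<Longrightarrow> g x \<le> a"
  proof -
    have "(\<integral>\<^sup>+x. ennreal (g x) * indicator B x \<partial>lborel) \<le> (\<integral>\<^sup>+x. ennreal a * indicator B x \<partial>lborel)"
      using that by (intro nn_integral_mono) (auto simp: indicator_def intro: ennreal_leI)
    then show ?thesis unfolding const dens using a by (subst (asm) ennreal_le_iff) auto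
  qed
qed

lemma scaled_bound_iff:
  fixes a d x y :: real
  assumes "0 < x" "0 < y"
  shows "a * (x / y) \<le> d \<longleftrightarrow> a \<le> y * d / x" and "d \<le> a * (x / y) \<longleftrightarrow> y * d / x \<le> a"
  using assms by (simp_all add: field_simps)

text \<open>
  The law has a density on \<open>[0, T]\<close> between \<open>f0\<close> and \<open>f1\<close> that gets arbitrarily close to \<open>f0\<close>
  near \<open>T\<close>. Stating this through the measures of Borel sets avoids the density itself.
\<close>
locale sample_sparsest_at_end = iid_sample +
  fixes T f0 f1 :: real
  assumes T_pos: "0 < T" and f0_pos: "0 < f0"
    and support: "measure \<nu> {0..T} = 1"
    and lower: "\<And>B. B \<in> sets borel \<Longrightarrow> B \<subseteq> {0..T} \<Longrightarrow> f0 * measure lborel B \<le> measure \<nu> B"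
    and upper: "\<And>B. B \<in> sets borel \<Longrightarrow> B \<subseteq> {0..T} \<Longrightarrow> measure \<nu> B \<le> f1 * measure lborel B"
    and sparse: "\<And>c. f0 < c \<Longrightarrow> \<exists>u. 0 \<le> u \<and> u < T \<and>
      (\<forall>B. B \<in> sets borel \<longrightarrow> B \<subseteq> {u..T} \<longrightarrow> measure \<nu> B \<le> c * measure lborel B)"
begin

lemma AE_in_support: "AE \<omega> in M. \<forall>i\<ge>1. X i \<omega> \<in> {0..T}"
proof -
  have "AE \<omega> in M. i \<ge> 1 \<longrightarrow> X i \<omega> \<in> {0..T}" for i
  proof (cases "i \<ge> 1")
    case True
    have "prob {\<omega>\<in>space M. X i \<omega> \<in> {0..T}} = 1" using prob_X[OF True, of "{0..T}"] support by simp
    then have "AE \<omega> in M. \<omega> \<in> {\<omega>\<in>space M. X i \<omega> \<in> {0..T}}"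
      by (rule AE_prob_1)
    then show ?thesis by auto
  qed auto
  then show ?thesis by (simp add: AE_all_countable)
qed

lemma AE_eventually_isolated_near_end:
  assumes "0 \<le> \<alpha>" "0 \<le> \<beta>" "(\<alpha> + \<beta>) * f0 < 1" "s < T"
  shows "\<exists>u v. s \<le> u \<and> u < v \<and> v < T \<and> (AE \<omega> in M. eventually (\<lambda>n. \<exists>i\<in>{1..n}. X i \<omega> \<in> {u..v} \<and>
           (\<forall>j\<in>{1..n} - {i}. X j \<omega> \<notin> {X i \<omega> - \<alpha> * (ln n / n)..X i \<omega> + \<beta> * (ln n / n)})) sequentially)"
proof -
  \<comment> \<open>Any \<open>c > f0\<close> with \<open>(\<alpha> + \<beta>) c < 1\<close> will do.\<close>
  define c where "c = (if \<alpha> + \<beta> = 0 then f0 + 1 else (f0 + 1 / (\<alpha> + \<beta>)) / 2)"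
  have c: "f0 < c" "(\<alpha> + \<beta>) * c < 1"
  proof -
    define \<gamma> where "\<gamma> = \<alpha> + \<beta>"
    have "f0 < c \<and> \<gamma> * c < 1"
    proof (cases "\<gamma> = 0")
      case False
      then have "0 < \<gamma>" using assms by (simp add: \<gamma>_def)
      then have "f0 < 1 / \<gamma>" "\<gamma> * c = (\<gamma> * f0 + 1) / 2"
        using assms(3) False by (auto simp: c_def \<gamma>_def[symmetric] field_simps)
      then show ?thesis using assms(3) False by (simp add: c_def \<gamma>_def[symmetric])
    qed (simp add: c_def \<gamma>_def)
    then show "f0 < c" "(\<alpha> + \<beta>) * c < 1" by (simp_all add: \<gamma>_def)
  qed
  obtain u where u: "0 \<le> u" "u < T" "\<And>B. B \<in> sets borel \<Longrightarrow> B \<subseteq> {u..T} \<Longrightarrow> measure \<nu> B \<le> c * measure lborel B"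
    using sparse[OF c(1)] by blast
  define u' where "u' = max s u"
  define v where "v = (u' + T) / 2"
  have uv: "s \<le> u'" "0 \<le> u'" "u \<le> u'" "u' < v" "v < T" using u assms by (auto simp: u'_def v_def)
  have "AE \<omega> in M. eventually (\<lambda>n. \<exists>i\<in>{1..n}. X i \<omega> \<in> {u'..v} \<and>
           (\<forall>j\<in>{1..n} - {i}. X j \<omega> \<notin> {X i \<omega> - \<alpha> * (ln n / n)..X i \<omega> + \<beta> * (ln n / n)})) sequentially"
  proof (rule AE_eventually_isolated[OF uv(4) f0_pos _ _ assms(1,2) c(2)])
    fix B :: "real set" assume B: "B \<in> sets borel" "B \<subseteq> {u'..v}"
    show "f0 * measure lborel B \<le> measure \<nu> B" using B uv by (intro lower) auto
    show "measure \<nu> B \<le> c * measure lborel B" using B uv by (intro u(3)) auto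
  qed
  then show ?thesis using uv by blast
qed

text \<open>
  A sample point near \<open>T\<close> with an empty window to its right separates the graph if there is a sample
  point further to the right. The existence statement for isolated points, used a second time with
  \<open>\<alpha> = \<beta> = 0\<close> on an interval closer to \<open>T\<close>, supplies one.
\<close>
lemma AE_eventually_connectivity_dist_ge:
  assumes b: "0 \<le> b" "b * f0 < 1"
  shows "AE \<omega> in M. eventually (\<lambda>n. b * (ln n / n) \<le> connectivity_dist (\<lambda>i. X i \<omega>) n) sequentially"
proof -
  obtain u v where uv: "u < v" "v < T"
    and isol: "AE \<omega> in M. eventually (\<lambda>n. \<exists>i\<in>{1..n}. X i \<omega> \<in> {u..v} \<and>
           (\<forall>j\<in>{1..n} - {i}. X j \<omega> \<notin> {X i \<omega> - 0 * (ln n / n)..X i \<omega> + b * (ln n / n)})) sequentially"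
    using AE_eventually_isolated_near_end[of 0 b 0] b T_pos by auto
  define w where "w = (v + T) / 2"
  obtain u' v' where u': "w \<le> u'"
    and far: "AE \<omega> in M. eventually (\<lambda>n. \<exists>i\<in>{1..n}. X i \<omega> \<in> {u'..v'} \<and>
           (\<forall>j\<in>{1..n} - {i}. X j \<omega> \<notin> {X i \<omega> - 0 * (ln n / n)..X i \<omega> + 0 * (ln n / n)})) sequentially"
    using AE_eventually_isolated_near_end[of 0 0 w] uv by (auto simp: w_def)
  from isol far show ?thesis
  proof eventually_elim
    case (elim \<omega>)
    then show ?case
    proof eventually_elim
      case (elim n)
      obtain i where i: "i \<in> {1..n}" "X i \<omega> \<in> {u..v}"
        and iso: "\<And>j. j \<in> {1..n} - {i} \<Longrightarrow> X j \<omega> \<notin> {X i \<omega>..X i \<omega> + b * (ln n / n)}"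
        using elim(1) by auto
      obtain j where j: "j \<in> {1..n}" "X j \<omega> \<in> {u'..v'}" using elim(2) by blast
      show ?case
      proof (rule connectivity_dist_ge[OF i(1) j(1)])
        show "X i \<omega> < X j \<omega>" using i j uv u' by (auto simp: w_def)
        fix k assume k: "k \<in> {1..n}" "X i \<omega> < X k \<omega>"
        then have "k \<in> {1..n} - {i}" by auto
        from iso[OF this] k show "X i \<omega> + b * (ln n / n) < X k \<omega>" by auto
      qed
    qed
  qed
qed

lemma AE_eventually_connectivity_dist_le:
  assumes b: "1 < b * f0"
  shows "AE \<omega> in M. eventually (\<lambda>n. connectivity_dist (\<lambda>i. X i \<omega>) n \<le> b * (ln n / n)) sequentially"
proof -
  have b0: "0 < b" using b f0_pos by (metis less_trans zero_less_mult_pos2 zero_less_one)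
  have "AE \<omega> in M. eventually (\<lambda>n. \<forall>i\<in>{1..n}.
           0 \<le> X i \<omega> - 0 * (ln n / n) \<longrightarrow> X i \<omega> + b * (ln n / n) \<le> T \<longrightarrow>
           (\<exists>j\<in>{1..n} - {i}. X j \<omega> \<in> {X i \<omega> - 0 * (ln n / n)..X i \<omega> + b * (ln n / n)} - {X i \<omega>})) sequentially"
    using b b0 lower by (intro AE_eventually_neighbour_interior[OF f0_pos]) auto
  with AE_in_support show ?thesis
  proof eventually_elim
    case (elim \<omega>)
    from elim(2) show ?case using eventually_ge_at_top[of 2]
    proof eventually_elim
      case n: (elim n)
      show ?case
      proof (rule connectivity_dist_le)
        show "n \<ge> 1" "0 < b * (ln n / n)" using n b0 by auto
        fix i j assume ij: "i \<in> {1..n}" "j \<in> {1..n}" "X i \<omega> + b * (ln n / n) < X j \<omega>"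
        have "0 \<le> X i \<omega>" "X j \<omega> \<le> T" using elim(1) ij by auto
        then have "\<exists>k\<in>{1..n} - {i}. X k \<omega> \<in> {X i \<omega> - 0 * (ln n / n)..X i \<omega> + b * (ln n / n)} - {X i \<omega>}"
          using ij n(1) by force
        then show "\<exists>k\<in>{1..n}. X i \<omega> < X k \<omega> \<and> X k \<omega> \<le> X i \<omega> + b * (ln n / n)" by force
      qed
    qed
  qed
qed

lemma AE_eventually_largest_nn_dist_ge:
  assumes b: "0 \<le> b" "2 * b * f0 < 1"
  shows "AE \<omega> in M. eventually (\<lambda>n. b * (ln n / n) \<le> largest_nn_dist (\<lambda>i. X i \<omega>) n) sequentially"
proof -
  obtain u v where
    isol: "AE \<omega> in M. eventually (\<lambda>n. \<exists>i\<in>{1..n}. X i \<omega> \<in> {u..v} \<and>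
           (\<forall>j\<in>{1..n} - {i}. X j \<omega> \<notin> {X i \<omega> - b * (ln n / n)..X i \<omega> + b * (ln n / n)})) sequentially"
    using AE_eventually_isolated_near_end[of b b 0] b T_pos by auto
  then show ?thesis
  proof eventually_elim
    case (elim \<omega>)
    then show ?case using eventually_ge_at_top[of 2]
    proof eventually_elim
      case (elim n)
      then obtain i where i: "i \<in> {1..n}"
        and iso: "\<And>j. j \<in> {1..n} - {i} \<Longrightarrow> X j \<omega> \<notin> {X i \<omega> - b * (ln n / n)..X i \<omega> + b * (ln n / n)}"
        by blast
      show ?case
      proof (rule largest_nn_dist_ge[OF elim(2) i])
        fix j assume "j \<in> {1..n} - {i}"
        from iso[OF this] show "b * (ln n / n) \<le> \<bar>X i \<omega> - X j \<omega>\<bar>" by auto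
      qed
    qed
  qed
qed

lemma AE_eventually_largest_nn_dist_le:
  assumes b: "1 < 2 * b * f0"
  shows "AE \<omega> in M. eventually (\<lambda>n. largest_nn_dist (\<lambda>i. X i \<omega>) n \<le> b * (ln n / n)) sequentially"
proof -
  have b0: "0 < b" using b f0_pos
    by (metis less_trans zero_less_mult_pos2 zero_less_one zero_less_mult_pos zero_less_numeral)
  have "AE \<omega> in M. eventually (\<lambda>n. \<forall>i\<in>{1..n}.
           0 \<le> X i \<omega> - b * (ln n / n) \<longrightarrow> X i \<omega> + b * (ln n / n) \<le> T \<longrightarrow>
           (\<exists>j\<in>{1..n} - {i}. X j \<omega> \<in> {X i \<omega> - b * (ln n / n)..X i \<omega> + b * (ln n / n)} - {X i \<omega>})) sequentially"
    using b b0 lower by (intro AE_eventually_neighbour_interior[OF f0_pos]) auto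
  moreover have "AE \<omega> in M. eventually (\<lambda>n. \<forall>i\<in>{1..n}.
           X i \<omega> \<in> {0..T} \<longrightarrow> \<bar>X i \<omega> - e\<bar> \<le> b * (ln n / n) \<longrightarrow>
           (\<exists>j\<in>{1..n} - {i}. \<bar>X i \<omega> - X j \<omega>\<bar> \<le> b * (ln n / n))) sequentially" if "e = 0 \<or> e = T" for e
    by (rule AE_eventually_neighbour_boundary[OF f0_pos T_pos that lower upper b0])
  note this[of 0, simplified] this[of T, simplified]
  ultimately show ?thesis using AE_in_support
  proof eventually_elim
    case (elim \<omega>)
    from elim(1,2,3) show ?case using eventually_ge_at_top[of 2]
    proof eventually_elim
      case n: (elim n)
      show ?case
      proof (rule largest_nn_dist_le[OF n(4)])
        fix i assume i: "i \<in> {1..n}"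
        have Xi: "0 \<le> X i \<omega>" "X i \<omega> \<le> T" using elim(4) i by auto
        consider "\<bar>X i \<omega>\<bar> \<le> b * (ln n / n)" | "\<bar>X i \<omega> - T\<bar> \<le> b * (ln n / n)"
          | "0 \<le> X i \<omega> - b * (ln n / n)" "X i \<omega> + b * (ln n / n) \<le> T"
          using Xi by linarith
        then show "\<exists>j\<in>{1..n} - {i}. \<bar>X i \<omega> - X j \<omega>\<bar> \<le> b * (ln n / n)"
        proof cases
          case 1
          then show ?thesis using n(2) i Xi by auto
        next
          case 2
          then show ?thesis using n(3) i Xi by auto
        next
          case 3
          then obtain j where "j \<in> {1..n} - {i}" "X j \<omega> \<in> {X i \<omega> - b * (ln n / n)..X i \<omega> + b * (ln n / n)} - {X i \<omega>}"
            using n(1) i by blast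
          then show ?thesis by (intro bexI[of _ j]) auto
        qed
      qed
    qed
  qed
qed

theorem AE_connectivity_dist_tendsto:
  "AE \<omega> in M. (\<lambda>n. real n * connectivity_dist (\<lambda>i. X i \<omega>) n / ln (real n)) \<longlonglongrightarrow> 1 / f0"
proof (rule AE_tendsto_of_ratio_bounds)
  show "0 < 1 / f0" using f0_pos by simp
  fix \<epsilon> :: real assume \<epsilon>: "0 < \<epsilon>" "\<epsilon> < 1"
  have "AE \<omega> in M. eventually (\<lambda>n. (1 - \<epsilon>) / f0 * (ln n / n) \<le> connectivity_dist (\<lambda>i. X i \<omega>) n) sequentially"
    using \<epsilon> f0_pos by (intro AE_eventually_connectivity_dist_ge) auto
  moreover have "AE \<omega> in M. eventually (\<lambda>n. connectivity_dist (\<lambda>i. X i \<omega>) n \<le> (1 + \<epsilon>) / f0 * (ln n / n)) sequentially"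
    using \<epsilon> f0_pos by (intro AE_eventually_connectivity_dist_le) auto
  ultimately show "AE \<omega> in M. eventually (\<lambda>n. (1 - \<epsilon>) * (1 / f0) \<le> real n * connectivity_dist (\<lambda>i. X i \<omega>) n / ln (real n)
      \<and> real n * connectivity_dist (\<lambda>i. X i \<omega>) n / ln (real n) \<le> (1 + \<epsilon>) * (1 / f0)) sequentially"
  proof eventually_elim
    case (elim \<omega>)
    then show ?case using eventually_ge_at_top[of 2]
    proof eventually_elim
      case (elim n)
      have pos: "0 < ln (real n)" "0 < real n" using elim(3) by auto
      show ?case using elim(1,2) unfolding scaled_bound_iff[OF pos] by simp
    qed
  qed
qed

theorem AE_largest_nn_dist_tendsto:
  "AE \<omega> in M. (\<lambda>n. real n * largest_nn_dist (\<lambda>i. X i \<omega>) n / ln (real n)) \<longlonglongrightarrow> 1 / (2 * f0)"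
proof (rule AE_tendsto_of_ratio_bounds)
  show "0 < 1 / (2 * f0)" using f0_pos by simp
  fix \<epsilon> :: real assume \<epsilon>: "0 < \<epsilon>" "\<epsilon> < 1"
  have "AE \<omega> in M. eventually (\<lambda>n. (1 - \<epsilon>) / (2 * f0) * (ln n / n) \<le> largest_nn_dist (\<lambda>i. X i \<omega>) n) sequentially"
    using \<epsilon> f0_pos by (intro AE_eventually_largest_nn_dist_ge) auto
  moreover have "AE \<omega> in M. eventually (\<lambda>n. largest_nn_dist (\<lambda>i. X i \<omega>) n \<le> (1 + \<epsilon>) / (2 * f0) * (ln n / n)) sequentially"
    using \<epsilon> f0_pos by (intro AE_eventually_largest_nn_dist_le) auto
  ultimately show "AE \<omega> in M. eventually (\<lambda>n. (1 - \<epsilon>) * (1 / (2 * f0)) \<le> real n * largest_nn_dist (\<lambda>i. X i \<omega>) n / ln (real n)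
      \<and> real n * largest_nn_dist (\<lambda>i. X i \<omega>) n / ln (real n) \<le> (1 + \<epsilon>) * (1 / (2 * f0))) sequentially"
  proof eventually_elim
    case (elim \<omega>)
    then show ?case using eventually_ge_at_top[of 2]
    proof eventually_elim
      case (elim n)
      have pos: "0 < ln (real n)" "0 < real n" using elim(3) by auto
      show ?case using elim(1,2) unfolding scaled_bound_iff[OF pos] by simp
    qed
  qed
qed

end

section \<open>The truncated exponential law\<close>

theorem theorem10:
  fixes M :: "'a measure" and X :: "nat \<Rightarrow> 'a \<Rightarrow> real" and l T p :: real
  assumes "prob_space M"
    and "l > 0" and "T > 0"
    and "p = 1 - exp (- l * T)"
    and "prob_space.indep_vars M (\<lambda>_. borel) X {1..}"
    and "\<And>i. i \<ge> 1 \<Longrightarrow> distributed M lborel (X i) (\<lambda>x. ennreal (trunc_exp_density l T x))"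
  shows "(AE \<omega> in M.
           (\<lambda>n. real n * connectivity_dist (\<lambda>i. X i \<omega>) n / ln (real n))
             \<longlonglongrightarrow> p / (l * (1 - p)))
       \<and> (AE \<omega> in M.
           (\<lambda>n. real n * largest_nn_dist (\<lambda>i. X i \<omega>) n / ln (real n))
             \<longlonglongrightarrow> p / (2 * l * (1 - p)))"
proof -
  interpret prob_space M by fact
  define g where "g = trunc_exp_density l T"
  define \<nu> where "\<nu> = density lborel (\<lambda>x. ennreal (g x))"
  define f0 where "f0 = g T"
  define f1 where "f1 = g 0"
  have p: "0 < p" "p < 1" using assms by auto
  have g_in: "g x = l * exp (- l * x) / p" if "x \<in> {0..T}" for x
    using that assms(4) by (auto simp: g_def trunc_exp_density_def)
  have g_out: "g x = 0" if "x \<notin> {0..T}" for x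
    using that by (auto simp: g_def trunc_exp_density_def)
  have g_meas [measurable]: "g \<in> borel_measurable borel"
    unfolding g_def trunc_exp_density_def by measurable
  have g_mono: "g y \<le> g x" if "0 \<le> x" "x \<le> y" "y \<le> T" for x y
    using that p assms(2) by (simp add: g_in divide_right_mono)
  have f0_eq: "f0 = l * (1 - p) / p" using g_in[of T] assms by (simp add: f0_def)
  have f0: "0 < f0" using p assms(2) by (simp add: f0_eq)
  have f1: "0 < f1" using g_in[of 0] p assms by (simp add: f1_def)
  have distr: "distr M borel (X i) = \<nu>" if "i \<ge> 1" for i
  proof -
    have "distr M borel (X i) = distr M lborel (X i)" by (rule distr_cong) auto
    also have "\<dots> = \<nu>" using distributed_distr_eq_density[OF assms(6)[OF that]] by (simp add: \<nu>_def g_def)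
    finally show ?thesis .
  qed
  interpret iid_sample M X \<nu>
    by unfold_locales (use assms(5) distr in auto)
  interpret \<nu>: prob_space \<nu> by (rule law)
  note bounds = measure_density_lborel_bounds[OF g_meas, folded \<nu>_def, OF \<nu>.finite_measure_axioms]
  interpret sample_sparsest_at_end M X \<nu> T f0 f1
  proof
    show "0 < T" "0 < f0" by (fact assms(3), fact f0)
    have "emeasure \<nu> (- {0..T}) = 0"
    proof -
      have "emeasure \<nu> (- {0..T}) = (\<integral>\<^sup>+x. ennreal (g x) * indicator (- {0..T}) x \<partial>lborel)"
        unfolding \<nu>_def by (intro emeasure_density) auto
      also have "\<dots> = (\<integral>\<^sup>+(x :: real). 0 \<partial>lborel)"
      proof (intro nn_integral_cong)
        fix x
        show "ennreal (g x) * indicator (- {0..T}) x = 0"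
          using g_out[of x] by (cases "x \<in> {0..T}") simp_all
      qed
      finally show ?thesis by simp
    qed
    then have "measure \<nu> (space \<nu> - {0..T}) = 0" using law by (simp add: measure_def Compl_eq_Diff_UNIV)
    then show "measure \<nu> {0..T} = 1" using \<nu>.prob_compl[of "{0..T}"] law by simp
  next
    fix B :: "real set" assume B: "B \<in> sets borel" "B \<subseteq> {0..T}"
    show "f0 * measure lborel B \<le> measure \<nu> B"
      by (rule bounds(1)[OF B]) (use f0 g_mono[of _ T] B in \<open>auto simp: f0_def\<close>)
    show "measure \<nu> B \<le> f1 * measure lborel B"
      by (rule bounds(2)[OF B]) (use f1 g_mono[of 0] B in \<open>auto simp: f1_def\<close>)
  next
    fix c assume c: "f0 < c"
    have "((\<lambda>x. l * exp (- l * x) / p) \<longlongrightarrow> l * exp (- l * T) / p) (at_left T)"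
      by (intro tendsto_intros) (use p in auto)
    then have "eventually (\<lambda>x. l * exp (- l * x) / p < c) (at_left T)"
      using c g_in[of T] assms(3) by (intro order_tendstoD(2)) (auto simp: f0_def)
    then obtain b where b: "b < T" "\<And>x. b < x \<Longrightarrow> x < T \<Longrightarrow> l * exp (- l * x) / p < c"
      using eventually_at_left[of 0 T] assms(3) by auto
    define u where "u = (max 0 b + T) / 2"
    have u: "0 \<le> u" "u < T" "b < u" using b assms(3) by (auto simp: u_def)
    have "g u \<le> c" using g_in[of u] b(2)[of u] u by simp
    have "measure \<nu> B \<le> c * measure lborel B" if B: "B \<in> sets borel" "B \<subseteq> {u..T}" for B
    proof (rule bounds(2)[OF B])
      show "0 \<le> c" using c f0 by simp
      fix x assume "x \<in> B"
      then have "g x \<le> g u" using B u by (intro g_mono) auto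
      then show "g x \<le> c" using \<open>g u \<le> c\<close> by simp
    qed
    then show "\<exists>u. 0 \<le> u \<and> u < T \<and> (\<forall>B. B \<in> sets borel \<longrightarrow> B \<subseteq> {u..T} \<longrightarrow> measure \<nu> B \<le> c * measure lborel B)"
      using u by blast
  qed
  have "1 / f0 = p / (l * (1 - p))" "1 / (2 * f0) = p / (2 * l * (1 - p))"
    by (simp_all add: f0_eq)
  then show ?thesis
    using AE_connectivity_dist_tendsto AE_largest_nn_dist_tendsto by simp
qed

end
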